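(* Let $(X_i)_{i\ge1}$ be i.i.d. real random variables with $\mathbb{E}(X_1)=0$ and $\mathbb{V}(X_1)=1$, and assume there is $D>0$ such that $\log\mathbb{E}[\exp(\lambda X_1)]<\infty$ for all $\lambda\in(-D,D)$. For each $k\ge1$ let $\nu_k$ be a positive-integer-valued random variable, independent of the sequence $(X_i)_i$, with finite expectation $\mu_k=\mathbb{E}(\nu_k)$, and assume $\mu_k\to\infty$ as $k\to\infty$. Let $0<\alpha<1/2$ and assume that there exists $0<\gamma\le2\alpha$ such that the sequence $$\left(\frac{\nu_k}{\mu_k^{1+2\alpha-\gamma}}\right)_k$$ satisfies an LDP with speed $\mu_k^{\gamma}$ and a convex good rate function $I$ with $\lim_{y\to\infty}I(y)=\infty$. Then the sequence $$Z_{k,\alpha}:=\frac{1}{\mu_k^{1/2+\alpha}}\sum_{i=1}^{\nu_k}X_i,\qquad k\ge 1,$$ satisfies an MDP with speed $\mu_k^{\gamma}$ and rate function $$J(y)=\inf\left\{\frac{y^2}{2s}+I(s):\ s\in\mathbb{R},\ s>0\right\}.$$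
   Context: $\mathbb V$ denotes variance. A sequence of real random variables $(Y_k)_k$ satisfies a large deviation principle (LDP) with speed $v(k)$ (where $v(k)\to\infty$) and good rate function $I:\mathbb{R}\to[0,\infty]$ if: (i) for every $L\in[0,\infty)$ the level set $\{x\in\mathbb R: I(x)\le L\}$ is compact; (ii) for every open $G\subseteq\mathbb{R}$, $\liminf_{k\to\infty}\frac{1}{v(k)}\log\mathbb{P}(Y_k\in G)\ge-\inf_{x\in G}I(x)$; (iii) for every closed $A\subseteq\mathbb{R}$, $\limsup_{k\to\infty}\frac{1}{v(k)}\log\mathbb{P}(Y_k\in A)\le-\inf_{x\in A}I(x)$, with $\log 0=-\infty$ and $\inf\emptyset=+\infty$. Formally there is no distinction between a moderate deviation principle (MDP) and an LDP: "MDP with speed $v(k)$ and rate function $J$" means exactly that (i)--(iii) hold for $J$.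
   Formalization: The formal theorem additionally assumes that I(s) is finite for some s > 0; without this J is identically infinite and the claim is false (e.g. ν_k = k with γ < 2α, where I is 0 at 0 and infinite elsewhere). *)

theory Defs
  imports "HOL-Probability.Probability"
begin

text \<open>
  Independence of two random variables with values in possibly different types
  (the library's \<open>indep_var\<close> requires a common value type).
\<close>

definition indep_rv ::
  "'a measure \<Rightarrow> 'b measure \<Rightarrow> ('a \<Rightarrow> 'b) \<Rightarrow> 'c measure \<Rightarrow> ('a \<Rightarrow> 'c) \<Rightarrow> bool" where
  "indep_rv M S Y T Z \<longleftrightarrow>
     Y \<in> measurable M S \<and> Z \<in> measurable M T \<and>
     prob_space.indep_set M
       (sets (vimage_algebra (space M) Y S)) (sets (vimage_algebra (space M) Z T))"

text \<open>Logarithm of a probability, with the convention that the logarithm of 0 is minus infinity.\<close>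

definition log_prob :: "real \<Rightarrow> ereal" where
  "log_prob p = (if p = 0 then - \<infinity> else ereal (ln p))"

definition good_rate_function :: "(real \<Rightarrow> ereal) \<Rightarrow> bool" where
  "good_rate_function I \<longleftrightarrow>
     (\<forall>x. 0 \<le> I x) \<and> (\<forall>L::real. 0 \<le> L \<longrightarrow> compact {x. I x \<le> ereal L})"

text \<open>
  Sequences are indexed by \<open>k \<ge> 1\<close>; the value at index 0 is junk.
  The infimum over the empty set is \<open>\<infinity>\<close> in \<^typ>\<open>ereal\<close>.
\<close>

definition satisfies_LDP ::
  "'a measure \<Rightarrow> (nat \<Rightarrow> 'a \<Rightarrow> real) \<Rightarrow> (nat \<Rightarrow> real) \<Rightarrow> (real \<Rightarrow> ereal) \<Rightarrow> bool" where
  "satisfies_LDP M Y v I \<longleftrightarrow>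
     (\<forall>k\<ge>1. Y k \<in> borel_measurable M) \<and>
     filterlim v at_top sequentially \<and>
     good_rate_function I \<and>
     (\<forall>G. open G \<longrightarrow>
        - (INF x\<in>G. I x) \<le>
        liminf (\<lambda>k. ereal (1 / v k) * log_prob (measure M {\<omega> \<in> space M. Y k \<omega> \<in> G}))) \<and>
     (\<forall>A. closed A \<longrightarrow>
        limsup (\<lambda>k. ereal (1 / v k) * log_prob (measure M {\<omega> \<in> space M. Y k \<omega> \<in> A}))
        \<le> - (INF x\<in>A. I x))"

text \<open>
  The library's \<open>convex_on\<close> does not apply, since \<^typ>\<open>ereal\<close> is not a real vector space.
\<close>

definition convex_ereal :: "(real \<Rightarrow> ereal) \<Rightarrow> bool" where
  "convex_ereal I \<longleftrightarrow>
     (\<forall>x y t. 0 < t \<and> t < 1 \<longrightarrow>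
        I ((1 - t) * x + t * y) \<le> ereal (1 - t) * I x + ereal t * I y)"

end

theory Submission
  imports Defs "HOL-Real_Asymp.Real_Asymp"
begin

text \<open>
  Write \<open>a\<close> for the norming sequence, \<open>v\<close> for the speed and \<open>b = a\<^sup>2 / v\<close>, so that \<open>\<nu> / b\<close> is the
  sequence with the given LDP. Since \<open>v / a \<longrightarrow> 0\<close>, the exponents \<open>\<theta> v / a\<close> that matter for
  \<open>S\<^sub>n / a\<close> tend to \<open>0\<close>, where \<open>E exp (t X) = exp (t\<^sup>2 / 2 (1 + o(1)))\<close>; hence
  \<open>E exp (\<theta> v S\<^sub>n / a) = exp (v (\<theta>\<^sup>2 s / 2 + o(1)))\<close> uniformly over all \<open>n\<close> with \<open>n / b\<close> near \<open>s\<close>.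
  Chernoff's bound and exponential tilting turn this into the Gaussian rate \<open>y\<^sup>2 / (2 s)\<close> for \<open>S\<^sub>n / a\<close>.
  Conditioning on \<open>\<nu>\<close> gives the lower bound directly. For the upper bound, the values of \<open>\<nu> / b\<close> are cut off
  at a level where \<open>I\<close> is large, and the remaining compact interval is covered by finitely
  many small windows.
\<close>

subsection \<open>Large deviation principles as eventual exponential bounds\<close>

text \<open>The scales fit through one identity: with \<open>t = \<theta> * v / a\<close> and
  \<open>b * v = a\<^sup>2\<close>, the exponent \<open>n * t\<^sup>2 / 2\<close> equals
  \<open>v * \<theta>\<^sup>2 * (n / b) / 2\<close>, so sum and index are both measured at speed
  \<open>v\<close>. The delicate point is \<open>s = 0\<close>: it is missing from the infimum, yet
  near-minimisers may tend to it and windows around it carry probability. For compact level sets and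
  for the rate at 0, convexity deals with it. In the cover, \<open>\<theta>\<^sup>2 * s / 2\<close>
  vanishes there, so arbitrarily large tilts are free. \<open>I_nondegenerate\<close> excludes that
  \<open>I\<close> is infinite on the whole positive half-line, as happens for deterministic
  \<open>\<nu>\<close> with \<open>\<gamma> < 2 * \<alpha>\<close>. The new rate would then be
  infinite everywhere, and the upper bound on the whole line would contradict total mass one. Since
  the rate is even and nondecreasing in \<open>\<bar>y\<bar>\<close>, the upper bound reduces to the
  two-sided tails \<open>x \<le> \<bar>Z k \<omega>\<bar>\<close>.\<close>

lemma limsup_log_prob_le_iff:
  fixes v p :: "nat \<Rightarrow> real" and R :: ereal
  assumes v: "filterlim v at_top sequentially" and p: "\<And>k. 0 \<le> p k"
  shows "limsup (\<lambda>k. ereal (1 / v k) * log_prob (p k)) \<le> - R \<longleftrightarrow>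
    (\<forall>c. ereal c < R \<longrightarrow> (\<forall>\<^sub>F k in sequentially. p k \<le> exp (- c * v k)))"
    (is "?lhs \<longleftrightarrow> ?rhs")
proof -
  have pos: "\<forall>\<^sub>F k in sequentially. v k > 0"
    using v by (simp add: filterlim_at_top_dense)
  have iff: "ereal (1 / v k) * log_prob (p k) \<le> ereal (- c) \<longleftrightarrow> p k \<le> exp (- c * v k)"
    if "v k > 0" for k c
  proof (cases "p k = 0")
    case True
    then show ?thesis using that by (simp add: log_prob_def)
  next
    case False
    with p[of k] have "p k > 0" by simp
    then have "p k \<le> exp (- c * v k) \<longleftrightarrow> ln (p k) \<le> - c * v k"
      using ln_ge_iff ln_le_cancel_iff[of "p k" "exp (- c * v k)"] by simp
    then show ?thesis using that False by (simp add: log_prob_def field_simps)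
  qed
  show ?thesis
  proof
    assume L: ?lhs
    show ?rhs
    proof (intro allI impI)
      fix c assume c: "ereal c < R"
      have "- R < ereal (- c)" using c by (metis ereal_minus_less_minus uminus_ereal.simps(1))
      with L have "limsup (\<lambda>k. ereal (1 / v k) * log_prob (p k)) < ereal (- c)"
        by (rule le_less_trans)
      then have "\<forall>\<^sub>F k in sequentially. ereal (1 / v k) * log_prob (p k) < ereal (- c)"
        by (rule Limsup_lessD)
      with pos show "\<forall>\<^sub>F k in sequentially. p k \<le> exp (- c * v k)"
        by eventually_elim (use iff in \<open>auto dest: less_imp_le\<close>)
    qed
  next
    assume r: ?rhs
    show ?lhs
    proof (rule ccontr)
      assume "\<not> ?lhs"
      then obtain z where z: "- R < ereal z" "ereal z < limsup (\<lambda>k. ereal (1 / v k) * log_prob (p k))"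
        using ereal_dense2 by (meson not_le)
      have "ereal (- z) < R"
        using z(1) by (metis ereal_minus_less_minus uminus_ereal.simps(1) ereal_uminus_uminus)
      with r have "\<forall>\<^sub>F k in sequentially. p k \<le> exp (- (- z) * v k)" by blast
      with pos have "\<forall>\<^sub>F k in sequentially. ereal (1 / v k) * log_prob (p k) \<le> ereal z"
        by eventually_elim (use iff[of _ "- z"] in auto)
      then have "limsup (\<lambda>k. ereal (1 / v k) * log_prob (p k)) \<le> ereal z"
        by (rule Limsup_bounded)
      with z(2) show False by simp
    qed
  qed
qed

lemma liminf_log_prob_ge_iff:
  fixes v p :: "nat \<Rightarrow> real" and R :: ereal
  assumes v: "filterlim v at_top sequentially" and p: "\<And>k. 0 \<le> p k"
  shows "- R \<le> liminf (\<lambda>k. ereal (1 / v k) * log_prob (p k)) \<longleftrightarrow>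
    (\<forall>c. R < ereal c \<longrightarrow> (\<forall>\<^sub>F k in sequentially. exp (- c * v k) \<le> p k))"
    (is "?lhs \<longleftrightarrow> ?rhs")
proof -
  have pos: "\<forall>\<^sub>F k in sequentially. v k > 0"
    using v by (simp add: filterlim_at_top_dense)
  have iff: "ereal (- c) \<le> ereal (1 / v k) * log_prob (p k) \<longleftrightarrow> exp (- c * v k) \<le> p k"
    if "v k > 0" for k c
  proof (cases "p k = 0")
    case True
    then show ?thesis using that by (simp add: log_prob_def not_le)
  next
    case False
    with p[of k] have "p k > 0" by simp
    then have "exp (- c * v k) \<le> p k \<longleftrightarrow> - c * v k \<le> ln (p k)"
      using ln_ge_iff by simp
    then show ?thesis using that False by (simp add: log_prob_def field_simps)
  qed
  show ?thesis
  proof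
    assume L: ?lhs
    show ?rhs
    proof (intro allI impI)
      fix c assume c: "R < ereal c"
      have "ereal (- c) < - R" using c by (metis ereal_minus_less_minus uminus_ereal.simps(1))
      then have "ereal (- c) < liminf (\<lambda>k. ereal (1 / v k) * log_prob (p k))"
        using L by (rule less_le_trans)
      then have "\<forall>\<^sub>F k in sequentially. ereal (- c) < ereal (1 / v k) * log_prob (p k)"
        by (rule less_LiminfD)
      with pos show "\<forall>\<^sub>F k in sequentially. exp (- c * v k) \<le> p k"
        by eventually_elim (use iff in \<open>auto dest: less_imp_le\<close>)
    qed
  next
    assume r: ?rhs
    show ?lhs
    proof (rule ccontr)
      assume "\<not> ?lhs"
      then obtain z where z: "liminf (\<lambda>k. ereal (1 / v k) * log_prob (p k)) < ereal z" "ereal z < - R"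
        using ereal_dense2 by (meson not_le)
      have "R < ereal (- z)"
        using z(2) by (metis ereal_minus_less_minus uminus_ereal.simps(1) ereal_uminus_uminus)
      with r have "\<forall>\<^sub>F k in sequentially. exp (- (- z) * v k) \<le> p k" by blast
      with pos have "\<forall>\<^sub>F k in sequentially. ereal z \<le> ereal (1 / v k) * log_prob (p k)"
        by eventually_elim (use iff[of _ "- z"] in auto)
      then have "ereal z \<le> liminf (\<lambda>k. ereal (1 / v k) * log_prob (p k))"
        by (rule Liminf_bounded)
      with z(1) show False by simp
    qed
  qed
qed

text \<open>The later bounds all use this form: a real \<open>c\<close> strictly on one side of the
  infimum and one inequality for large \<open>k\<close>. The strict gap absorbs constants and error
  terms, and neither the logarithm of 0 nor an infinite infimum has to be handled again.\<close>

lemma satisfies_LDP_iff: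
  fixes M :: "'a measure"
  assumes "prob_space M"
  shows "satisfies_LDP M Y v I \<longleftrightarrow>
    (\<forall>k\<ge>1. Y k \<in> borel_measurable M) \<and> filterlim v at_top sequentially \<and> good_rate_function I \<and>
    (\<forall>G c. open G \<longrightarrow> (INF x\<in>G. I x) < ereal c \<longrightarrow>
      (\<forall>\<^sub>F k in sequentially. exp (- c * v k) \<le> measure M {\<omega> \<in> space M. Y k \<omega> \<in> G})) \<and>
    (\<forall>A c. closed A \<longrightarrow> ereal c < (INF x\<in>A. I x) \<longrightarrow>
      (\<forall>\<^sub>F k in sequentially. measure M {\<omega> \<in> space M. Y k \<omega> \<in> A} \<le> exp (- c * v k)))"
  unfolding satisfies_LDP_def
  by (auto simp: limsup_log_prob_le_iff liminf_log_prob_ge_iff)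

subsection \<open>The rate function\<close>

text \<open>The summand is the joint cost of index level \<open>s\<close> and sum value
  \<open>y\<close>: \<open>y\<^sup>2 / (2 * s)\<close> is the rate of a centred Gaussian of variance
  \<open>s\<close>. Minimising over \<open>s\<close> is the contraction to the second
  coordinate.\<close>

definition gaussian_mixture_rate :: "(real \<Rightarrow> ereal) \<Rightarrow> real \<Rightarrow> ereal" where
  "gaussian_mixture_rate I y = (INF s\<in>{0<..}. ereal (y\<^sup>2 / (2 * s)) + I s)"

lemma gaussian_mixture_rate_less_iff:
  "gaussian_mixture_rate I y < c \<longleftrightarrow> (\<exists>s>0. ereal (y\<^sup>2 / (2 * s)) + I s < c)"
  by (auto simp: gaussian_mixture_rate_def INF_less_iff)

lemma gaussian_mixture_rate_le: "s > 0 \<Longrightarrow> gaussian_mixture_rate I y \<le> ereal (y\<^sup>2 / (2 * s)) + I s"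
  unfolding gaussian_mixture_rate_def by (rule INF_lower) simp

lemma gaussian_mixture_rate_abs: "gaussian_mixture_rate I \<bar>y\<bar> = gaussian_mixture_rate I y"
  by (simp add: gaussian_mixture_rate_def)

lemma good_rate_function_nonneg: "good_rate_function I \<Longrightarrow> 0 \<le> I x"
  by (simp add: good_rate_function_def)

text \<open>Sublevel sets are closed: compact for \<open>c \<ge> 0\<close>, empty for
  \<open>c < 0\<close> because \<open>I\<close> is nonnegative.\<close>

lemma good_rate_function_lower_semicontinuous:
  assumes I: "good_rate_function I" and c: "ereal c < I s"
  shows "\<forall>\<^sub>F t in nhds s. ereal c < I t"
proof -
  have "closed {x. I x \<le> ereal c}"
  proof (cases "c \<ge> 0")
    case True
    then show ?thesis using I by (auto simp: good_rate_function_def intro: compact_imp_closed)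
  next
    case False
    then have "ereal c < I x" for x
      using good_rate_function_nonneg[OF I, of x] by (cases "I x") auto
    then have "{x. I x \<le> ereal c} = {}" by (auto simp: not_le)
    then show ?thesis by simp
  qed
  then have "open (- {x. I x \<le> ereal c})" by blast
  then have "\<forall>\<^sub>F t in nhds s. t \<in> - {x. I x \<le> ereal c}"
    by (rule eventually_nhds_in_open) (use c in simp)
  then show ?thesis by eventually_elim (simp add: not_le)
qed

text \<open>
  The infimum defining the rate omits \<open>s = 0\<close>; convexity along the segment from \<open>0\<close> to a point
  where \<open>I\<close> is finite shows that nothing is lost.
\<close>

lemma gaussian_mixture_rate_zero_le:
  assumes I: "good_rate_function I" and conv: "convex_ereal I" and s0: "s0 > 0" "I s0 < \<infinity>"
  shows "gaussian_mixture_rate I 0 \<le> I 0"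
proof (cases "I 0 = \<infinity>")
  case False
  obtain p where p: "I 0 = ereal p" "p \<ge> 0"
    using False good_rate_function_nonneg[OF I, of 0] by (cases "I 0") auto
  obtain q where q: "I s0 = ereal q" "q \<ge> 0"
    using s0(2) good_rate_function_nonneg[OF I, of s0] by (cases "I s0") auto
  show ?thesis
  proof (rule ereal_le_epsilon2)
    fix e :: real assume e: "e > 0"
    \<comment> \<open>The first entry keeps \<open>t < 1\<close>, the second gives
      \<open>t * q \<le> e\<close>; adding 1 covers \<open>q = 0\<close>.\<close>
    define t where "t = min (1/2) (e / (q + 1))"
    have t: "0 < t" "t < 1" using e q by (auto simp: t_def)
    have "t * q \<le> t * (q + 1)" using t by simp
    also have "\<dots> \<le> e / (q + 1) * (q + 1)" using q by (intro mult_right_mono) (auto simp: t_def)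
    also have "\<dots> = e" using q by simp
    finally have tq: "t * q \<le> e" .
    have "gaussian_mixture_rate I 0 \<le> I (t * s0)"
      using gaussian_mixture_rate_le[of "t * s0" I 0] t s0 by simp
    also have "\<dots> \<le> ereal (1 - t) * I 0 + ereal t * I s0"
      using conv[unfolded convex_ereal_def, rule_format, of t 0 s0] t by simp
    also have "\<dots> = ereal ((1 - t) * p + t * q)" by (simp add: p q)
    also have "\<dots> \<le> ereal (p + e)"
      using tq mult_left_le_one_le[of p "1 - t"] t p by simp
    finally show "gaussian_mixture_rate I 0 \<le> I 0 + ereal e" by (simp add: p)
  qed
qed simp

text \<open>The infimum need not be attained, so each \<open>y n\<close> is paired with a
  near-minimiser \<open>s n\<close>. The pairs stay in a compact rectangle, and lower semicontinuity
  of \<open>I\<close> passes to the limit of a subsequence.\<close>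

lemma good_rate_function_gaussian_mixture_rate:
  assumes I: "good_rate_function I" and conv: "convex_ereal I" and s0: "s0 > 0" "I s0 < \<infinity>"
  shows "good_rate_function (gaussian_mixture_rate I)"
  unfolding good_rate_function_def
proof (intro conjI allI impI)
  note I0 = good_rate_function_nonneg[OF I]
  show "0 \<le> gaussian_mixture_rate I x" for x
    unfolding gaussian_mixture_rate_def by (rule INF_greatest) (simp add: I0)
  fix L :: real assume L: "0 \<le> L"
  have "compact {x. I x \<le> ereal (L + 1)}" using I L by (simp add: good_rate_function_def)
  then obtain R where R: "R > 0" "\<And>s. I s \<le> ereal (L + 1) \<Longrightarrow> \<bar>s\<bar> \<le> R"
    by (auto dest!: compact_imp_bounded simp: bounded_pos)
  \<comment> \<open>The quadratic part of the cost is at most \<open>L + 1\<close> and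
    \<open>s \<le> R\<close>, hence \<open>y\<^sup>2 \<le> 2 * R * (L + 1)\<close>.\<close>
  define C where "C = sqrt (2 * R * (L + 1))"
  show "compact {x. gaussian_mixture_rate I x \<le> ereal L}"
    unfolding compact_def
  proof (intro allI impI)
    fix y :: "nat \<Rightarrow> real" assume y: "\<forall>n. y n \<in> {x. gaussian_mixture_rate I x \<le> ereal L}"
    have "\<forall>n. \<exists>s. s > 0 \<and> ereal ((y n)\<^sup>2 / (2 * s)) + I s < ereal (L + inverse (real (Suc n)))"
    proof
      fix n
      have "gaussian_mixture_rate I (y n) < ereal (L + inverse (real (Suc n)))"
        by (rule le_less_trans[of _ "ereal L"]) (use y in auto)
      then show "\<exists>s. s > 0 \<and> ereal ((y n)\<^sup>2 / (2 * s)) + I s < ereal (L + inverse (real (Suc n)))"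
        by (simp only: gaussian_mixture_rate_less_iff)
    qed
    from choice[OF this] obtain s where "\<forall>n. s n > 0 \<and> ereal ((y n)\<^sup>2 / (2 * s n)) + I (s n) < ereal (L + inverse (real (Suc n)))"
      by blast
    then have s: "\<And>n. s n > 0"
      "\<And>n. ereal ((y n)\<^sup>2 / (2 * s n)) + I (s n) < ereal (L + inverse (real (Suc n)))"
      by blast+
    have bounds: "I (s n) \<le> ereal (L + inverse (real (Suc n))) \<and> s n \<le> R \<and> (y n)\<^sup>2 \<le> 2 * s n * (L + 1)" for n
    proof -
      obtain i where i: "I (s n) = ereal i" "i \<ge> 0"
        using s(2)[of n] I0[of "s n"] by (cases "I (s n)") auto
      have "(y n)\<^sup>2 / (2 * s n) \<ge> 0" using s(1)[of n] by simp
      moreover have "inverse (real (Suc n)) \<le> 1" by (simp add: inverse_le_1_iff)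
      moreover have "(y n)\<^sup>2 / (2 * s n) + i < L + inverse (real (Suc n))" using s(2)[of n] i by simp
      ultimately have "i \<le> L + inverse (real (Suc n))" "i \<le> L + 1" "(y n)\<^sup>2 / (2 * s n) \<le> L + 1"
        using i by linarith+
      then show ?thesis using i R(2)[of "s n"] s(1)[of n] by (simp add: field_simps)
    qed
    have mem: "(y n, s n) \<in> {-C..C} \<times> {0..R}" for n
    proof -
      have "s n * (L + 1) \<le> R * (L + 1)" using bounds[of n] L by (intro mult_right_mono) auto
      then have "(y n)\<^sup>2 \<le> 2 * R * (L + 1)" using bounds[of n] by linarith
      then have "\<bar>y n\<bar> \<le> C" unfolding C_def by (metis real_sqrt_abs real_sqrt_le_mono)
      then show ?thesis using bounds[of n] s(1)[of n] by auto
    qed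
    have "compact ({-C..C} \<times> {0..R})" by (intro compact_Times compact_Icc)
    from this[unfolded compact_def, rule_format, of "\<lambda>n. (y n, s n)", OF mem]
    obtain l r where l: "strict_mono (r :: nat \<Rightarrow> nat)" "((\<lambda>n. (y n, s n)) \<circ> r) \<longlonglongrightarrow> l" "l \<in> {-C..C} \<times> {0..R}"
      by blast
    obtain y' s' where l': "l = (y', s')" by (cases l)
    have lim: "(\<lambda>n. y (r n)) \<longlonglongrightarrow> y'" "(\<lambda>n. s (r n)) \<longlonglongrightarrow> s'"
      using tendsto_fst[OF l(2)] tendsto_snd[OF l(2)] by (simp_all add: l' comp_def)
    have "s' \<ge> 0" using l(3) l' by simp
    have inv: "(\<lambda>n. L + inverse (real (Suc (r n)))) \<longlonglongrightarrow> L"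
      using LIMSEQ_subseq_LIMSEQ[OF LIMSEQ_inverse_real_of_nat_add l(1), of L] by (simp add: comp_def)
    have lsc: "\<forall>\<^sub>F n in sequentially. ereal c < I (s (r n))" if "ereal c < I s'" for c
      using good_rate_function_lower_semicontinuous[OF I that] lim(2) by (rule eventually_compose_filterlim)
    have "gaussian_mixture_rate I y' \<le> ereal L"
    proof (cases "s' = 0")
      \<comment> \<open>If the minimisers tend to 0, then
        \<open>y\<^sup>2 \<le> 2 * s * (L + 1)\<close> forces \<open>y' = 0\<close>, the one point
        where the missing value \<open>I 0\<close> can be recovered by convexity.\<close>
      case True
      have "I s' \<le> ereal L"
      proof (rule ccontr)
        assume "\<not> I s' \<le> ereal L"
        then obtain c where c: "ereal L < ereal c" "ereal c < I s'" using ereal_dense2 by (meson not_le)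
        have "\<forall>\<^sub>F n in sequentially. L + inverse (real (Suc (r n))) < c"
          by (rule order_tendstoD(2)[OF inv]) (use c in simp)
        with lsc[OF c(2)] have "\<forall>\<^sub>F n in sequentially. False"
        proof eventually_elim
          case (elim n)
          have "ereal c < ereal (L + inverse (real (Suc (r n))))"
            using elim(1) bounds[of "r n"] by (meson less_le_trans)
          then show ?case using elim(2) by simp
        qed
        then show False by simp
      qed
      moreover have "y' = 0"
      proof -
        have "(\<lambda>n. (y (r n))\<^sup>2) \<longlonglongrightarrow> y'\<^sup>2" by (intro tendsto_intros lim)
        moreover have "(\<lambda>n. 2 * s (r n) * (L + 1)) \<longlonglongrightarrow> 2 * s' * (L + 1)" by (intro tendsto_intros lim)
        ultimately have "y'\<^sup>2 \<le> 2 * s' * (L + 1)"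
          by (rule LIMSEQ_le) (use bounds in auto)
        then show ?thesis using True by simp
      qed
      ultimately show ?thesis
        using gaussian_mixture_rate_zero_le[OF I conv s0] True by simp
    next
      case False
      then have "s' > 0" using \<open>s' \<ge> 0\<close> by simp
      have "ereal (y'\<^sup>2 / (2 * s')) + I s' \<le> ereal L"
      proof (rule ccontr)
        assume *: "\<not> ?thesis"
        then have "ereal (L - y'\<^sup>2 / (2 * s')) < I s'" by (cases "I s'") auto
        then obtain c where c: "ereal (L - y'\<^sup>2 / (2 * s')) < ereal c" "ereal c < I s'"
          using ereal_dense2 by blast
        have "(\<lambda>n. (L + inverse (real (Suc (r n)))) - (y (r n))\<^sup>2 / (2 * s (r n))) \<longlonglongrightarrow> L - y'\<^sup>2 / (2 * s')"
          by (intro tendsto_intros lim inv) (use \<open>s' > 0\<close> in auto)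
        then have "\<forall>\<^sub>F n in sequentially. (L + inverse (real (Suc (r n)))) - (y (r n))\<^sup>2 / (2 * s (r n)) < c"
          by (rule order_tendstoD) (use c in simp)
        with lsc[OF c(2)] have "\<forall>\<^sub>F n in sequentially. False"
        proof eventually_elim
          case (elim n)
          then show ?case using s(2)[of "r n"] by (cases "I (s (r n))") auto
        qed
        then show False by simp
      qed
      with gaussian_mixture_rate_le[OF \<open>s' > 0\<close>] show ?thesis by (rule order_trans)
    qed
    then show "\<exists>l\<in>{x. gaussian_mixture_rate I x \<le> ereal L}. \<exists>r. strict_mono r \<and> (y \<circ> r) \<longlonglongrightarrow> l"
      using l(1) lim(1) by (auto simp: comp_def intro!: bexI[of _ y'] exI[of _ r])
  qed
qed

subsection \<open>Moment generating functions and tilting\<close>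

text \<open>Lagrange form of the Taylor remainder. The factor \<open>u\<^sup>2\<close> cancels the
  division by \<open>t\<^sup>2\<close> in \<open>mgf_second_order\<close>.\<close>

lemma exp_minus_one_minus_bound:
  fixes u :: real
  shows "\<bar>exp u - 1 - u\<bar> \<le> u\<^sup>2 / 2 * exp \<bar>u\<bar>"
proof -
  obtain t where t: "\<bar>t\<bar> \<le> \<bar>u\<bar>" "exp u = (\<Sum>m<2. u ^ m / fact m) + exp t / fact 2 * u ^ 2"
    using Maclaurin_exp_le[of u 2] by blast
  have e: "exp u - 1 - u = u\<^sup>2 / 2 * exp t" using t(2) by (simp add: numeral_2_eq_2)
  have "exp t \<le> exp \<bar>u\<bar>" using t(1) by simp
  then show ?thesis unfolding e by (simp add: abs_mult mult_left_mono)
qed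

lemma exp_second_difference_tendsto:
  fixes y :: real
  shows "((\<lambda>t. (exp (t * y) - 1 - t * y) / t\<^sup>2) \<longlongrightarrow> y\<^sup>2 / 2) (at 0)"
proof -
  consider "y = 0" | "y > 0" | "y < 0" by linarith
  then show ?thesis
  proof cases
    case 1
    then show ?thesis by simp
  next
    case 2
    then show ?thesis by (real_asymp, simp_all add: power2_eq_square)
  next
    case 3
    then show ?thesis by (real_asymp, simp_all add: power2_eq_square)
  qed
qed

context prob_space
begin

text \<open>For \<open>0 < d < D\<close>, \<open>d * \<bar>Y\<bar> \<le> exp (d * \<bar>Y\<bar>)
  \<le> exp (d * Y) + exp (- d * Y)\<close> pointwise.\<close>

lemma integrable_if_exp_integrable:
  fixes Y :: "'a \<Rightarrow> real"
  assumes [measurable]: "Y \<in> borel_measurable M"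
    and exp: "\<And>l. l \<in> {-D<..<D} \<Longrightarrow> integrable M (\<lambda>\<omega>. exp (l * Y \<omega>))" and "D > 0"
  shows "integrable M Y"
proof -
  define d where "d = D / 2"
  have d: "d > 0" "d \<in> {-D<..<D}" "- d \<in> {-D<..<D}" using \<open>D > 0\<close> by (auto simp: d_def)
  show ?thesis
  proof (rule Bochner_Integration.integrable_bound)
    show "integrable M (\<lambda>\<omega>. (exp (d * Y \<omega>) + exp (- d * Y \<omega>)) / d)"
      using exp[OF d(2)] exp[OF d(3)] by auto
    show "AE \<omega> in M. norm (Y \<omega>) \<le> norm ((exp (d * Y \<omega>) + exp (- d * Y \<omega>)) / d)"
    proof (rule AE_I2)
      fix \<omega>
      have "d * \<bar>Y \<omega>\<bar> \<le> exp (d * \<bar>Y \<omega>\<bar>)" using exp_ge_add_one_self[of "d * \<bar>Y \<omega>\<bar>"] by linarith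
      also have "\<dots> \<le> exp (d * Y \<omega>) + exp (- d * Y \<omega>)" by (cases "Y \<omega> \<ge> 0") (auto simp: abs_if)
      finally show "norm (Y \<omega>) \<le> norm ((exp (d * Y \<omega>) + exp (- d * Y \<omega>)) / d)"
        using d(1) by (simp add: field_simps)
    qed
  qed simp
qed

text \<open>Dominated convergence for the second difference quotient of \<open>exp (t * Y)\<close>.
  Mean zero makes the linear term disappear and identifies the limit with half the variance.\<close>

lemma mgf_second_order:
  fixes Y :: "'a \<Rightarrow> real"
  assumes Y[measurable]: "Y \<in> borel_measurable M"
    and exp: "\<And>l. l \<in> {-D<..<D} \<Longrightarrow> integrable M (\<lambda>\<omega>. exp (l * Y \<omega>))" and "D > 0"
    and mean: "expectation Y = 0"
  shows "((\<lambda>t. (expectation (\<lambda>\<omega>. exp (t * Y \<omega>)) - 1) / t\<^sup>2) \<longlongrightarrow> variance Y / 2) (at 0)"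
proof -
  \<comment> \<open>The majorant has exponent \<open>2 * d\<close>, which must stay below
    \<open>D\<close>: one \<open>exp (d * \<bar>Y\<bar>)\<close> comes from the Taylor remainder, a
    second one dominates the quadratic factor.\<close>
  define d where "d = D / 3"
  have d: "d > 0" "2 * d \<in> {-D<..<D}" "- (2 * d) \<in> {-D<..<D}" using \<open>D > 0\<close> by (auto simp: d_def)
  have Y_int: "integrable M Y" by (rule integrable_if_exp_integrable[OF Y exp \<open>D > 0\<close>])
  define g where "g t \<omega> = (exp (t * Y \<omega>) - 1 - t * Y \<omega>) / t\<^sup>2" for t \<omega>
  define w where "w \<omega> = (exp (2 * d * Y \<omega>) + exp (- (2 * d) * Y \<omega>)) / d\<^sup>2" for \<omega>
  have g_meas[measurable]: "g t \<in> borel_measurable M" for t unfolding g_def by measurable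
  have w_int: "integrable M w"
    unfolding w_def using exp[OF d(2)] exp[OF d(3)] by auto
  have bound: "norm (g t \<omega>) \<le> w \<omega>" if "\<bar>t\<bar> < d" for t \<omega>
  proof (cases "t = 0")
    case True
    then show ?thesis by (simp add: g_def w_def)
  next
    case False
    define u where "u = d * \<bar>Y \<omega>\<bar>"
    have u: "u \<ge> 0" using d by (simp add: u_def)
    have "\<bar>t * Y \<omega>\<bar> \<le> u" using that by (simp add: u_def abs_mult mult_right_mono)
    then have e: "exp \<bar>t * Y \<omega>\<bar> \<le> exp u" by simp
    have "norm (g t \<omega>) = \<bar>exp (t * Y \<omega>) - 1 - t * Y \<omega>\<bar> / t\<^sup>2" by (simp add: g_def)
    also have "\<dots> \<le> ((t * Y \<omega>)\<^sup>2 / 2 * exp \<bar>t * Y \<omega>\<bar>) / t\<^sup>2"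
      by (intro divide_right_mono exp_minus_one_minus_bound) simp
    also have "\<dots> = (Y \<omega>)\<^sup>2 / 2 * exp \<bar>t * Y \<omega>\<bar>" using False by (simp add: power_mult_distrib)
    also have "\<dots> \<le> (Y \<omega>)\<^sup>2 / 2 * exp u" by (intro mult_left_mono e) simp
    also have "\<dots> = u\<^sup>2 / 2 * exp u / d\<^sup>2" using d by (simp add: u_def power_mult_distrib)
    also have "\<dots> \<le> exp u * exp u / d\<^sup>2"
      using exp_lower_Taylor_quadratic[OF u] u by (intro divide_right_mono mult_right_mono) auto
    also have "exp u * exp u = exp (2 * d * \<bar>Y \<omega>\<bar>)" by (simp add: u_def flip: exp_add)
    also have "\<dots> / d\<^sup>2 \<le> w \<omega>"
      unfolding w_def by (intro divide_right_mono) (cases "Y \<omega> \<ge> 0"; auto simp: abs_if)+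
    finally show ?thesis .
  qed
  have "((\<lambda>t. expectation (g t)) \<longlongrightarrow> expectation (\<lambda>\<omega>. (Y \<omega>)\<^sup>2 / 2)) (at 0)"
    unfolding tendsto_at_iff_sequentially comp_def
  proof (intro allI impI)
    fix t :: "nat \<Rightarrow> real" assume t: "\<forall>i. t i \<in> UNIV - {0}" "t \<longlonglongrightarrow> 0"
    from t(2) d(1) have "\<forall>\<^sub>F i in sequentially. \<bar>t i\<bar> < d"
      by (auto dest!: tendstoD simp: dist_real_def)
    then obtain N where N: "\<And>i. i \<ge> N \<Longrightarrow> \<bar>t i\<bar> < d" by (auto simp: eventually_sequentially)
    have "(\<lambda>i. expectation (g (t (i + N)))) \<longlonglongrightarrow> expectation (\<lambda>\<omega>. (Y \<omega>)\<^sup>2 / 2)"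
    proof (rule integral_dominated_convergence[OF _ _ w_int])
      show "AE \<omega> in M. (\<lambda>i. g (t (i + N)) \<omega>) \<longlonglongrightarrow> (Y \<omega>)\<^sup>2 / 2"
      proof (rule AE_I2)
        fix \<omega>
        have "(\<lambda>i. g (t i) \<omega>) \<longlonglongrightarrow> (Y \<omega>)\<^sup>2 / 2"
          using exp_second_difference_tendsto[of "Y \<omega>"] t
          unfolding tendsto_at_iff_sequentially comp_def g_def by blast
        then show "(\<lambda>i. g (t (i + N)) \<omega>) \<longlonglongrightarrow> (Y \<omega>)\<^sup>2 / 2" by (rule LIMSEQ_ignore_initial_segment)
      qed
      show "AE \<omega> in M. norm (g (t (i + N)) \<omega>) \<le> w \<omega>" for i using bound N by auto
    qed auto
    then show "(\<lambda>i. expectation (g (t i))) \<longlonglongrightarrow> expectation (\<lambda>\<omega>. (Y \<omega>)\<^sup>2 / 2)" by (rule LIMSEQ_offset)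
  qed
  then have "((\<lambda>t. expectation (g t)) \<longlongrightarrow> variance Y / 2) (at 0)" by (simp add: mean)
  moreover have "\<forall>\<^sub>F t in at 0. expectation (g t) = (expectation (\<lambda>\<omega>. exp (t * Y \<omega>)) - 1) / t\<^sup>2"
  proof -
    have "\<forall>\<^sub>F t in at 0. t \<in> {-D<..<D}"
      by (rule eventually_at_in_open') (use \<open>D > 0\<close> in auto)
    then show ?thesis
    proof eventually_elim
      case (elim t)
      have "expectation (g t) = expectation (\<lambda>\<omega>. exp (t * Y \<omega>) - 1 - t * Y \<omega>) / t\<^sup>2"
        by (simp add: g_def[abs_def])
      also have "\<dots> = (expectation (\<lambda>\<omega>. exp (t * Y \<omega>)) - 1) / t\<^sup>2"
        using exp[OF elim] Y_int mean by (simp add: prob_space)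
      finally show ?case .
    qed
  qed
  ultimately show ?thesis by (rule Lim_transform_eventually)
qed

text \<open>Compare second-order coefficients at 0; above, \<open>1 + x \<le> exp x\<close>
  finishes. The filter is \<open>nhds 0\<close> rather than \<open>at 0\<close>, because tilts equal
  to 0 occur later; there all three terms are 1.\<close>

lemma mgf_gaussian_sandwich:
  fixes Y :: "'a \<Rightarrow> real"
  assumes Y[measurable]: "Y \<in> borel_measurable M"
    and exp: "\<And>l. l \<in> {-D<..<D} \<Longrightarrow> integrable M (\<lambda>\<omega>. exp (l * Y \<omega>))" and "D > 0"
    and mean: "expectation Y = 0" and var: "variance Y = 1" and "\<epsilon> > 0"
  shows "\<forall>\<^sub>F t in nhds 0. exp ((1 - \<epsilon>) * t\<^sup>2 / 2) \<le> expectation (\<lambda>\<omega>. exp (t * Y \<omega>)) \<and>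
      expectation (\<lambda>\<omega>. exp (t * Y \<omega>)) \<le> exp ((1 + \<epsilon>) * t\<^sup>2 / 2)"
proof -
  define m where "m t = expectation (\<lambda>\<omega>. exp (t * Y \<omega>))" for t
  have lim: "((\<lambda>t. (m t - 1) / t\<^sup>2) \<longlongrightarrow> 1 / 2) (at 0)"
    using mgf_second_order[OF Y exp \<open>D > 0\<close> mean] by (simp add: m_def var)
  have lim': "((\<lambda>t. (exp ((1 - \<epsilon>) * t\<^sup>2 / 2) - 1) / t\<^sup>2) \<longlongrightarrow> (1 - \<epsilon>) / 2) (at 0)"
  proof -
    have "((\<lambda>t. (exp (c * t\<^sup>2 / 2) - 1) / t\<^sup>2) \<longlongrightarrow> c / 2) (at 0)" for c :: real
    proof -
      consider "c = 0" | "c > 0" | "c < 0" by linarith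
      then show ?thesis by cases (simp, real_asymp+)
    qed
    then show ?thesis by blast
  qed
  have nz: "\<forall>\<^sub>F t in at (0::real). t \<noteq> 0" by (simp add: eventually_at_filter)
  have up: "\<forall>\<^sub>F t in at 0. (m t - 1) / t\<^sup>2 < (1 + \<epsilon>) / 2"
    using lim by (rule order_tendstoD) (use \<open>\<epsilon> > 0\<close> in auto)
  \<comment> \<open>The separating value is the midpoint of the two limits
    \<open>(1 - \<epsilon>) / 2\<close> and \<open>1 / 2\<close>.\<close>
  have lo: "\<forall>\<^sub>F t in at 0. (1 - \<epsilon> / 2) / 2 < (m t - 1) / t\<^sup>2"
    using lim by (rule order_tendstoD) (use \<open>\<epsilon> > 0\<close> in auto)
  have lo': "\<forall>\<^sub>F t in at 0. (exp ((1 - \<epsilon>) * t\<^sup>2 / 2) - 1) / t\<^sup>2 < (1 - \<epsilon> / 2) / 2"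
    using lim' by (rule order_tendstoD) (use \<open>\<epsilon> > 0\<close> in auto)
  have "\<forall>\<^sub>F t in at 0. exp ((1 - \<epsilon>) * t\<^sup>2 / 2) \<le> m t \<and> m t \<le> exp ((1 + \<epsilon>) * t\<^sup>2 / 2)"
    using up lo lo' nz
  proof eventually_elim
    case (elim t)
    have "t\<^sup>2 > 0" using elim by simp
    have "(exp ((1 - \<epsilon>) * t\<^sup>2 / 2) - 1) / t\<^sup>2 < (m t - 1) / t\<^sup>2" using elim by linarith
    then have 1: "exp ((1 - \<epsilon>) * t\<^sup>2 / 2) \<le> m t" using elim(4) by (simp add: divide_less_cancel)
    have "m t - 1 \<le> (1 + \<epsilon>) / 2 * t\<^sup>2" using elim(1) \<open>t\<^sup>2 > 0\<close> by (simp add: pos_divide_less_eq)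
    then have "m t \<le> 1 + (1 + \<epsilon>) * t\<^sup>2 / 2" by simp
    also have "\<dots> \<le> exp ((1 + \<epsilon>) * t\<^sup>2 / 2)" by (rule exp_ge_add_one_self)
    finally show ?case using 1 by simp
  qed
  then show ?thesis
    unfolding eventually_at_filter m_def by (rule eventually_mono) (auto simp: prob_space)
qed

section \<open>Tail and ball probabilities from exponential moments\<close>

text \<open>Markov's inequality for \<open>exp (l * S)\<close>. With \<open>l\<close> kept on both
  sides of the event, positive \<open>l\<close> gives the upper tail and negative \<open>l\<close>
  the lower one.\<close>

lemma chernoff_signed:
  fixes S :: "'a \<Rightarrow> real"
  assumes [measurable]: "S \<in> borel_measurable M" and int: "integrable M (\<lambda>\<omega>. exp (l * S \<omega>))"
  shows "prob {\<omega> \<in> space M. l * S \<omega> \<ge> l * x} \<le> exp (- (l * x)) * expectation (\<lambda>\<omega>. exp (l * S \<omega>))"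
proof -
  let ?A = "{\<omega> \<in> space M. l * S \<omega> \<ge> l * x}"
  have "prob ?A = expectation (indicator ?A)" by simp
  also have "\<dots> \<le> expectation (\<lambda>\<omega>. exp (- (l * x)) * exp (l * S \<omega>))"
    by (intro integral_mono integrable_mult_right int integrable_real_indicator)
      (auto simp: emeasure_eq_measure indicator_def simp flip: exp_add)
  finally show ?thesis by simp
qed

text \<open>
  Cramer's change of measure without a change of measure: the part of the tilted expectation
  carried by \<open>S \<ge> y + \<epsilon>\<close> or \<open>S \<le> y - \<epsilon>\<close> is bounded by tilting a little further to either side.
\<close>

lemma tilted_ball_lower_bound:
  fixes S :: "'a \<Rightarrow> real"
  assumes [measurable]: "S \<in> borel_measurable M" and "\<delta> \<ge> 0"
    and int: "integrable M (\<lambda>\<omega>. exp (l * S \<omega>))" "integrable M (\<lambda>\<omega>. exp ((l + \<delta>) * S \<omega>))"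
      "integrable M (\<lambda>\<omega>. exp ((l - \<delta>) * S \<omega>))"
  shows "exp (- l * y - \<bar>l\<bar> * \<epsilon>) *
      (expectation (\<lambda>\<omega>. exp (l * S \<omega>))
       - exp (- \<delta> * (y + \<epsilon>)) * expectation (\<lambda>\<omega>. exp ((l + \<delta>) * S \<omega>))
       - exp (\<delta> * (y - \<epsilon>)) * expectation (\<lambda>\<omega>. exp ((l - \<delta>) * S \<omega>)))
    \<le> prob {\<omega> \<in> space M. \<bar>S \<omega> - y\<bar> < \<epsilon>}"
proof -
  let ?A = "{\<omega> \<in> space M. \<bar>S \<omega> - y\<bar> < \<epsilon>}"
  let ?f = "\<lambda>\<omega>. exp (- l * y - \<bar>l\<bar> * \<epsilon>) * (exp (l * S \<omega>)
       - exp (- \<delta> * (y + \<epsilon>)) * exp ((l + \<delta>) * S \<omega>) - exp (\<delta> * (y - \<epsilon>)) * exp ((l - \<delta>) * S \<omega>))"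
  \<comment> \<open>Integrating this gives the claim. On the ball the prefactor outweighs the
    largest possible \<open>exp (l * S \<omega>)\<close>; off it, one subtracted term already
    exceeds \<open>exp (l * S \<omega>)\<close>.\<close>
  have "?f \<omega> \<le> indicator ?A \<omega>" if "\<omega> \<in> space M" for \<omega>
  proof (cases "\<bar>S \<omega> - y\<bar> < \<epsilon>")
    case True
    have "l * (S \<omega> - y) \<le> \<bar>l\<bar> * \<epsilon>"
      using mult_left_mono[of "\<bar>S \<omega> - y\<bar>" \<epsilon> "\<bar>l\<bar>"] True abs_ge_self[of "l * (S \<omega> - y)"] by (simp add: abs_mult)
    then have "exp (- l * y - \<bar>l\<bar> * \<epsilon>) * exp (l * S \<omega>) \<le> 1"
      by (simp add: algebra_simps flip: exp_add)
    moreover have "?f \<omega> \<le> exp (- l * y - \<bar>l\<bar> * \<epsilon>) * exp (l * S \<omega>)"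
      by (intro mult_left_mono) (auto simp: add_nonneg_nonneg algebra_simps)
    ultimately have "?f \<omega> \<le> 1" by (rule order_trans[rotated])
    then show ?thesis using True that by (simp only: indicator_simps mem_Collect_eq simp_thms)
  next
    case False
    then consider "S \<omega> \<ge> y + \<epsilon>" | "S \<omega> \<le> y - \<epsilon>" by linarith
    then have "exp (l * S \<omega>) - exp (- \<delta> * (y + \<epsilon>)) * exp ((l + \<delta>) * S \<omega>)
        - exp (\<delta> * (y - \<epsilon>)) * exp ((l - \<delta>) * S \<omega>) \<le> 0"
    proof cases
      case 1
      then have "\<delta> * (y + \<epsilon>) \<le> \<delta> * S \<omega>" using \<open>\<delta> \<ge> 0\<close> by (rule mult_left_mono)
      then have "exp (l * S \<omega>) \<le> exp (- \<delta> * (y + \<epsilon>)) * exp ((l + \<delta>) * S \<omega>)"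
        by (simp add: algebra_simps flip: exp_add)
      then show ?thesis by (simp add: add_increasing add_increasing2 diff_le_eq)
    next
      case 2
      then have "\<delta> * S \<omega> \<le> \<delta> * (y - \<epsilon>)" using \<open>\<delta> \<ge> 0\<close> by (rule mult_left_mono)
      then have "exp (l * S \<omega>) \<le> exp (\<delta> * (y - \<epsilon>)) * exp ((l - \<delta>) * S \<omega>)"
        by (simp add: algebra_simps flip: exp_add)
      then show ?thesis by (simp add: add_increasing add_increasing2 diff_le_eq)
    qed
    then have "?f \<omega> \<le> 0" by (intro mult_nonneg_nonpos) auto
    then show ?thesis using False by simp
  qed
  moreover have "integrable M ?f" using int by auto
  moreover have "integrable M (indicator ?A :: 'a \<Rightarrow> real)"
    by (intro integrable_real_indicator) (auto simp: emeasure_eq_measure)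
  ultimately have "expectation ?f \<le> expectation (indicator ?A)" by (intro integral_mono)
  then show ?thesis using int by simp
qed

end

subsection \<open>Partial sums of i.i.d. variables\<close>

locale iid_exp_moments = prob_space M for M :: "'a measure" +
  fixes X :: "nat \<Rightarrow> 'a \<Rightarrow> real" and D :: real
  assumes X_indep: "indep_vars (\<lambda>_. borel) X {1..}"
    and X_ident: "\<And>i. i \<ge> 1 \<Longrightarrow> distr M borel (X i) = distr M borel (X 1)"
    and X_mean: "expectation (X 1) = 0"
    and X_var: "variance (X 1) = 1"
    and D_pos: "D > 0"
    and X_mgf: "\<And>l. l \<in> {-D<..<D} \<Longrightarrow> integrable M (\<lambda>\<omega>. exp (l * X 1 \<omega>))"
begin

definition S :: "nat \<Rightarrow> 'a \<Rightarrow> real" where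
  "S n \<omega> = (\<Sum>i=1..n. X i \<omega>)"

definition mgf :: "real \<Rightarrow> real" where
  "mgf t = expectation (\<lambda>\<omega>. exp (t * X 1 \<omega>))"

lemma X_measurable: "i \<ge> 1 \<Longrightarrow> X i \<in> borel_measurable M"
  using X_indep by (auto simp: indep_vars_def)

lemma S_measurable [measurable]: "S n \<in> borel_measurable M"
  unfolding S_def by (intro borel_measurable_sum X_measurable) simp

lemma
  assumes t: "t \<in> {-D<..<D}"
  shows integrable_exp_S: "integrable M (\<lambda>\<omega>. exp (t * S n \<omega>))"
    and expectation_exp_S: "expectation (\<lambda>\<omega>. exp (t * S n \<omega>)) = mgf t ^ n"
proof -
  let ?E = "\<lambda>i \<omega>. exp (t * X i \<omega>)"
  have e: "exp (t * S n \<omega>) = (\<Prod>i=1..n. ?E i \<omega>)" for \<omega>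
    by (simp add: S_def sum_distrib_left exp_sum)
  have indep: "indep_vars (\<lambda>_. borel) ?E {1..n}"
    by (intro indep_vars_compose2[OF indep_vars_subset[OF X_indep]]) auto
  have one: "integrable M (?E i) \<and> expectation (?E i) = mgf t" if "i \<ge> 1" for i
  proof -
    note [measurable] = X_measurable[OF that] X_measurable[of 1] X_measurable[of 1, simplified]
    have "integrable M (?E i) \<longleftrightarrow> integrable (distr M borel (X i)) (\<lambda>x. exp (t * x))"
      by (subst integrable_distr_eq) auto
    also have "\<dots> \<longleftrightarrow> integrable M (?E 1)"
      unfolding X_ident[OF that] by (subst integrable_distr_eq) auto
    finally have "integrable M (?E i)" using X_mgf[OF t] by simp
    moreover have "expectation (?E i) = integral\<^sup>L (distr M borel (X i)) (\<lambda>x. exp (t * x))"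
      by (subst integral_distr) auto
    moreover have "\<dots> = mgf t"
      unfolding X_ident[OF that] mgf_def by (subst integral_distr) auto
    ultimately show ?thesis by simp
  qed
  show "integrable M (\<lambda>\<omega>. exp (t * S n \<omega>))"
    unfolding e by (intro indep_vars_integrable indep) (use one in auto)
  have "expectation (\<lambda>\<omega>. exp (t * S n \<omega>)) = (\<Prod>i=1..n. expectation (?E i))"
    unfolding e by (intro indep_vars_lebesgue_integral indep) (use one in auto)
  also have "\<dots> = (\<Prod>i=1..n. mgf t)" by (intro prod.cong) (use one in auto)
  finally show "expectation (\<lambda>\<omega>. exp (t * S n \<omega>)) = mgf t ^ n" by simp
qed

lemma mgf_sandwich:
  assumes "\<epsilon> > 0"
  shows "\<forall>\<^sub>F t in nhds 0. exp ((1 - \<epsilon>) * t\<^sup>2 / 2) \<le> mgf t \<and> mgf t \<le> exp ((1 + \<epsilon>) * t\<^sup>2 / 2)"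
  unfolding mgf_def
  by (rule mgf_gaussian_sandwich[OF X_measurable X_mgf D_pos X_mean X_var assms]) auto

section \<open>Conditioning on an independent index\<close>

text \<open>Split by the value of \<open>N\<close>; each event factorises since \<open>S n\<close>
  is a measurable function of the sequence. The predicate \<open>P\<close> will be a window for the
  index.\<close>

lemma random_index_decomposition:
  fixes N :: "'a \<Rightarrow> nat"
  assumes N: "N \<in> measurable M (count_space UNIV)"
    and indep: "indep_rv M (count_space UNIV) N (\<Pi>\<^sub>M i\<in>{1..}. borel) (\<lambda>\<omega>. \<lambda>i\<in>{1..}. X i \<omega>)"
    and B: "B \<in> sets borel"
  shows "(\<lambda>n. prob {\<omega> \<in> space M. N \<omega> = n \<and> P n}) sums prob {\<omega> \<in> space M. P (N \<omega>)}"
    and "(\<lambda>n. prob {\<omega> \<in> space M. N \<omega> = n \<and> P n} * prob {\<omega> \<in> space M. S n \<omega> \<in> B})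
      sums prob {\<omega> \<in> space M. P (N \<omega>) \<and> S (N \<omega>) \<omega> \<in> B}"
proof -
  note [measurable] = N B
  let ?F = "\<lambda>n. {\<omega> \<in> space M. N \<omega> = n \<and> P n}"
  let ?E = "\<lambda>n. {\<omega> \<in> space M. (N \<omega> = n \<and> P n) \<and> S n \<omega> \<in> B}"
  have "(\<lambda>n. prob (?F n)) sums prob (\<Union>n. ?F n)"
    by (intro finite_measure_UNION) (auto simp: disjoint_family_on_def)
  also have "(\<Union>n. ?F n) = {\<omega> \<in> space M. P (N \<omega>)}" by auto
  finally show "(\<lambda>n. prob (?F n)) sums prob {\<omega> \<in> space M. P (N \<omega>)}" .
  have prod: "prob (?E n) = prob (?F n) * prob {\<omega> \<in> space M. S n \<omega> \<in> B}" for n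
  proof -
    \<comment> \<open>Pulling back this set of sequences puts the event for \<open>S n\<close> into
      the sigma-algebra that is independent of \<open>N\<close>.\<close>
    let ?T = "{f \<in> space (\<Pi>\<^sub>M i\<in>{1..}. borel). (\<Sum>i=1..n. f i) \<in> B} :: (nat \<Rightarrow> real) set"
    have T: "?T \<in> sets (\<Pi>\<^sub>M i\<in>{1..}. borel)"
    proof -
      have [measurable]: "(\<lambda>f. \<Sum>i=1..n. f i) \<in> borel_measurable (\<Pi>\<^sub>M i\<in>{1..}. (borel :: real measure))"
        by (intro borel_measurable_sum measurable_component_singleton) auto
      show ?thesis by measurable
    qed
    have "?F n \<in> sets (vimage_algebra (space M) N (count_space UNIV))"
    proof -
      have *: "?F n = N -` {m. m = n \<and> P n} \<inter> space M" by auto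
      show ?thesis unfolding * by (rule in_vimage_algebra) simp
    qed
    moreover have "{\<omega> \<in> space M. S n \<omega> \<in> B} \<in>
        sets (vimage_algebra (space M) (\<lambda>\<omega>. \<lambda>i\<in>{1..}. X i \<omega>) (\<Pi>\<^sub>M i\<in>{1..}. borel))"
    proof -
      have *: "{\<omega> \<in> space M. S n \<omega> \<in> B} = (\<lambda>\<omega>. \<lambda>i\<in>{1..}. X i \<omega>) -` ?T \<inter> space M"
        by (auto simp: S_def space_PiM)
      show ?thesis unfolding * by (rule in_vimage_algebra[OF T])
    qed
    ultimately have "prob (?F n \<inter> {\<omega> \<in> space M. S n \<omega> \<in> B}) =
        prob (?F n) * prob {\<omega> \<in> space M. S n \<omega> \<in> B}"
      using indep unfolding indep_rv_def by (blast intro: indep_setD)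
    moreover have "?F n \<inter> {\<omega> \<in> space M. S n \<omega> \<in> B} = ?E n" by auto
    ultimately show ?thesis by simp
  qed
  have "(\<lambda>n. prob (?E n)) sums prob (\<Union>n. ?E n)"
    by (intro finite_measure_UNION) (auto simp: disjoint_family_on_def)
  also have "(\<Union>n. ?E n) = {\<omega> \<in> space M. P (N \<omega>) \<and> S (N \<omega>) \<omega> \<in> B}" by auto
  finally show "(\<lambda>n. prob (?F n) * prob {\<omega> \<in> space M. S n \<omega> \<in> B})
      sums prob {\<omega> \<in> space M. P (N \<omega>) \<and> S (N \<omega>) \<omega> \<in> B}"
    unfolding prod .
qed

text \<open>The two series are compared termwise. Terms with \<open>P n\<close> false vanish, so a
  bound on \<open>S n\<close> is required only inside the window.\<close>

lemma
  fixes N :: "'a \<Rightarrow> nat"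
  assumes N: "N \<in> measurable M (count_space UNIV)"
    and indep: "indep_rv M (count_space UNIV) N (\<Pi>\<^sub>M i\<in>{1..}. borel) (\<lambda>\<omega>. \<lambda>i\<in>{1..}. X i \<omega>)"
    and B: "B \<in> sets borel"
  shows random_index_upper: "(\<And>n. P n \<Longrightarrow> prob {\<omega> \<in> space M. S n \<omega> \<in> B} \<le> q) \<Longrightarrow>
      prob {\<omega> \<in> space M. P (N \<omega>) \<and> S (N \<omega>) \<omega> \<in> B} \<le> prob {\<omega> \<in> space M. P (N \<omega>)} * q"
    and random_index_lower: "(\<And>n. P n \<Longrightarrow> q \<le> prob {\<omega> \<in> space M. S n \<omega> \<in> B}) \<Longrightarrow>
      prob {\<omega> \<in> space M. P (N \<omega>)} * q \<le> prob {\<omega> \<in> space M. P (N \<omega>) \<and> S (N \<omega>) \<omega> \<in> B}"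
proof -
  note d = random_index_decomposition[OF assms, of P]
  note d1 = sums_mult2[OF d(1), of q]
  show "prob {\<omega> \<in> space M. P (N \<omega>) \<and> S (N \<omega>) \<omega> \<in> B} \<le> prob {\<omega> \<in> space M. P (N \<omega>)} * q"
    if *: "\<And>n. P n \<Longrightarrow> prob {\<omega> \<in> space M. S n \<omega> \<in> B} \<le> q"
  proof (rule sums_le[OF _ d(2) d1])
    show "prob {\<omega> \<in> space M. N \<omega> = n \<and> P n} * prob {\<omega> \<in> space M. S n \<omega> \<in> B} \<le>
        prob {\<omega> \<in> space M. N \<omega> = n \<and> P n} * q" for n
      by (cases "P n") (auto intro: mult_left_mono *)
  qed
  show "prob {\<omega> \<in> space M. P (N \<omega>)} * q \<le> prob {\<omega> \<in> space M. P (N \<omega>) \<and> S (N \<omega>) \<omega> \<in> B}"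
    if *: "\<And>n. P n \<Longrightarrow> q \<le> prob {\<omega> \<in> space M. S n \<omega> \<in> B}"
  proof (rule sums_le[OF _ d1 d(2)])
    show "prob {\<omega> \<in> space M. N \<omega> = n \<and> P n} * q \<le>
        prob {\<omega> \<in> space M. N \<omega> = n \<and> P n} * prob {\<omega> \<in> space M. S n \<omega> \<in> B}" for n
      by (cases "P n") (auto intro: mult_left_mono *)
  qed
qed

end

section \<open>Exponential bounds for partial sums, uniform over index windows\<close>

locale iid_moderate_scaling = iid_exp_moments +
  fixes a v b :: "nat \<Rightarrow> real"
  assumes v_lim: "filterlim v at_top sequentially"
    and a_pos: "\<forall>\<^sub>F k in sequentially. a k > 0"
    and v_over_a: "(\<lambda>k. v k / a k) \<longlonglongrightarrow> 0"
    and b_eq: "\<forall>\<^sub>F k in sequentially. b k * v k = (a k)\<^sup>2"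
begin

lemma v_pos: "\<forall>\<^sub>F k in sequentially. v k > 0"
  using v_lim by (simp add: filterlim_at_top_dense)

text \<open>As \<open>v\<close> tends to infinity, any strict gap between rates absorbs a constant
  factor: two tails, the side terms of a tilt, or the number of windows in a finite cover.\<close>

lemma eventually_exp_le:
  assumes "c < c'" "C > 0"
  shows "\<forall>\<^sub>F k in sequentially. C * exp (- c' * v k) \<le> exp (- c * v k)"
proof -
  have "\<forall>\<^sub>F k in sequentially. ln C / (c' - c) \<le> v k"
    using v_lim by (simp add: filterlim_at_top)
  then show ?thesis
  proof eventually_elim
    case (elim k)
    have "ln C \<le> (c' - c) * v k" using elim assms by (simp add: pos_divide_le_eq mult.commute)
    then have "C \<le> exp ((c' - c) * v k)" using assms ln_ge_iff[of C] by (metis exp_le_cancel_iff exp_ln)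
    then have "C * exp (- c' * v k) \<le> exp ((c' - c) * v k) * exp (- c' * v k)" by (intro mult_right_mono) auto
    also have "\<dots> = exp (- c * v k)" by (simp add: algebra_simps flip: exp_add)
    finally show ?case .
  qed
qed

text \<open>
  The quantifier over \<open>n\<close> stands inside the eventuality, so that \<open>n\<close> may later be replaced by
  the random index.
\<close>

lemma exp_moment_window:
  assumes "s \<ge> 0" "\<kappa> > 0"
  shows "\<exists>\<eta>>0. \<forall>\<theta>. \<forall>\<^sub>F k in sequentially. \<forall>n. \<bar>real n / b k - s\<bar> < \<eta> \<longrightarrow>
    integrable M (\<lambda>\<omega>. exp (\<theta> * v k * (S n \<omega> / a k))) \<and>
    exp (v k * (\<theta>\<^sup>2 * (s - \<kappa>) / 2)) \<le> expectation (\<lambda>\<omega>. exp (\<theta> * v k * (S n \<omega> / a k))) \<and>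
    expectation (\<lambda>\<omega>. exp (\<theta> * v k * (S n \<omega> / a k))) \<le> exp (v k * (\<theta>\<^sup>2 * (s + \<kappa>) / 2))"
proof -
  \<comment> \<open>Half of \<open>\<kappa>\<close> pays for the distance of \<open>n / b\<close>
    from \<open>s\<close>. The other half pays for the relative error \<open>\<epsilon>\<close> of
    the exponent, using \<open>n / b \<le> s + 1\<close>. As \<open>\<eta>\<close> does not depend
    on \<open>\<theta>\<close>, one window serves several tilts at once.\<close>
  define \<eta> where "\<eta> = min 1 (\<kappa> / 2)"
  define \<epsilon> where "\<epsilon> = \<kappa> / (2 * (s + 1))"
  have "\<eta> > 0" "\<epsilon> > 0" using assms by (auto simp: \<eta>_def \<epsilon>_def)
  have es: "\<epsilon> * (s + 1) = \<kappa> / 2" using assms by (simp add: \<epsilon>_def field_simps)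
  show ?thesis
  proof (intro exI[of _ \<eta>] conjI \<open>\<eta> > 0\<close> allI)
    fix \<theta> :: real
    have lim: "(\<lambda>k. \<theta> * (v k / a k)) \<longlonglongrightarrow> 0" using tendsto_mult_left[OF v_over_a, of \<theta>] by simp
    have 1: "\<forall>\<^sub>F k in sequentially. \<theta> * (v k / a k) \<in> {-D<..<D}"
      by (rule topological_tendstoD[OF lim]) (use D_pos in auto)
    have 2: "\<forall>\<^sub>F k in sequentially. exp ((1 - \<epsilon>) * (\<theta> * (v k / a k))\<^sup>2 / 2) \<le> mgf (\<theta> * (v k / a k)) \<and>
        mgf (\<theta> * (v k / a k)) \<le> exp ((1 + \<epsilon>) * (\<theta> * (v k / a k))\<^sup>2 / 2)"
      using mgf_sandwich[OF \<open>\<epsilon> > 0\<close>] lim by (rule eventually_compose_filterlim)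
    show "\<forall>\<^sub>F k in sequentially. \<forall>n. \<bar>real n / b k - s\<bar> < \<eta> \<longrightarrow>
      integrable M (\<lambda>\<omega>. exp (\<theta> * v k * (S n \<omega> / a k))) \<and>
      exp (v k * (\<theta>\<^sup>2 * (s - \<kappa>) / 2)) \<le> expectation (\<lambda>\<omega>. exp (\<theta> * v k * (S n \<omega> / a k))) \<and>
      expectation (\<lambda>\<omega>. exp (\<theta> * v k * (S n \<omega> / a k))) \<le> exp (v k * (\<theta>\<^sup>2 * (s + \<kappa>) / 2))"
      using 1 2 a_pos v_pos b_eq
    proof eventually_elim
      case (elim k)
      define t where "t = \<theta> * (v k / a k)"
      have t: "t \<in> {-D<..<D}" "exp ((1 - \<epsilon>) * t\<^sup>2 / 2) \<le> mgf t" "mgf t \<le> exp ((1 + \<epsilon>) * t\<^sup>2 / 2)"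
        using elim by (auto simp: t_def)
      have ez: "(\<lambda>\<omega>. exp (\<theta> * v k * (S n \<omega> / a k))) = (\<lambda>\<omega>. exp (t * S n \<omega>))" for n
        by (simp add: t_def)
      show ?case
      proof (intro allI impI)
        fix n assume n: "\<bar>real n / b k - s\<bar> < \<eta>"
        define r where "r = real n / b k"
        have "b k > 0" using elim by (metis zero_less_mult_pos2 zero_less_power)
        then have r: "r \<ge> 0" "r \<le> s + 1" "\<bar>r - s\<bar> \<le> \<kappa> / 2"
          using n by (auto simp: r_def \<eta>_def)
        have "\<epsilon> * r \<le> \<kappa> / 2" using mult_left_mono[OF r(2), of \<epsilon>] \<open>\<epsilon> > 0\<close> es by simp
        then have r': "s - \<kappa> \<le> (1 - \<epsilon>) * r" "(1 + \<epsilon>) * r \<le> s + \<kappa>"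
          using r(3) unfolding left_diff_distrib distrib_right by linarith+
        \<comment> \<open>Here \<open>b k * v k\<close> cancels \<open>(a k)\<^sup>2\<close>: the
          choice of \<open>b\<close> turns \<open>n\<close> summands into \<open>v k\<close> times
          the normalised index \<open>r\<close>.\<close>
        have "real n * t\<^sup>2 = \<theta>\<^sup>2 * (v k * (r * (b k * v k) / (a k)\<^sup>2))"
          using \<open>b k > 0\<close> elim by (simp add: t_def r_def power2_eq_square field_simps)
        also have "\<dots> = v k * (\<theta>\<^sup>2 * r)" using elim by simp
        finally have nt: "real n * t\<^sup>2 = v k * (\<theta>\<^sup>2 * r)" .
        have pw: "exp (c * t\<^sup>2 / 2) ^ n = exp (v k * (\<theta>\<^sup>2 * (c * r) / 2))" for c
        proof -
          have "exp (c * t\<^sup>2 / 2) ^ n = exp (real n * (c * t\<^sup>2 / 2))" by (rule exp_of_nat_mult[symmetric])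
          also have "real n * (c * t\<^sup>2 / 2) = c / 2 * (real n * t\<^sup>2)" by simp
          finally show ?thesis unfolding nt by (simp add: mult_ac)
        qed
        have "exp (v k * (\<theta>\<^sup>2 * (s - \<kappa>) / 2)) \<le> exp (v k * (\<theta>\<^sup>2 * ((1 - \<epsilon>) * r) / 2))"
          using r' elim by (simp add: mult_left_mono)
        also have "\<dots> \<le> mgf t ^ n" unfolding pw[symmetric] by (intro power_mono t) simp
        finally have A: "exp (v k * (\<theta>\<^sup>2 * (s - \<kappa>) / 2)) \<le> mgf t ^ n" .
        have "0 \<le> mgf t" by (rule order_trans[OF _ t(2)]) simp
        then have "mgf t ^ n \<le> exp (v k * (\<theta>\<^sup>2 * ((1 + \<epsilon>) * r) / 2))"
          unfolding pw[symmetric] by (intro power_mono t)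
        also have "\<dots> \<le> exp (v k * (\<theta>\<^sup>2 * (s + \<kappa>) / 2))"
          using r' elim by (simp add: mult_left_mono)
        finally have B: "mgf t ^ n \<le> exp (v k * (\<theta>\<^sup>2 * (s + \<kappa>) / 2))" .
        show "integrable M (\<lambda>\<omega>. exp (\<theta> * v k * (S n \<omega> / a k))) \<and>
          exp (v k * (\<theta>\<^sup>2 * (s - \<kappa>) / 2)) \<le> expectation (\<lambda>\<omega>. exp (\<theta> * v k * (S n \<omega> / a k))) \<and>
          expectation (\<lambda>\<omega>. exp (\<theta> * v k * (S n \<omega> / a k))) \<le> exp (v k * (\<theta>\<^sup>2 * (s + \<kappa>) / 2))"
          unfolding ez expectation_exp_S[OF t(1)] using A B integrable_exp_S[OF t(1)] by blast
      qed
    qed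
  qed
qed

text \<open>Chernoff's bound with tilts \<open>\<theta>\<close> and \<open>- \<theta>\<close>. The
  tilt is left free because the optimal \<open>x / s\<close> does not exist at
  \<open>s = 0\<close>.\<close>

lemma abs_partial_sum_upper:
  assumes "s \<ge> 0" "\<theta> \<ge> 0" and c: "c < \<theta> * x - \<theta>\<^sup>2 * s / 2"
  shows "\<exists>\<eta>>0. \<forall>\<^sub>F k in sequentially. \<forall>n. \<bar>real n / b k - s\<bar> < \<eta> \<longrightarrow>
    prob {\<omega> \<in> space M. x \<le> \<bar>S n \<omega> / a k\<bar>} \<le> exp (- c * v k)"
proof -
  define g where "g = \<theta> * x - \<theta>\<^sup>2 * s / 2 - c"
  \<comment> \<open>The window error \<open>\<theta>\<^sup>2 * \<kappa> / 2\<close> then uses at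
    most half of the slack \<open>g\<close>; adding 1 covers \<open>\<theta> = 0\<close>.\<close>
  define \<kappa> where "\<kappa> = g / (\<theta>\<^sup>2 + 1)"
  have g: "g > 0" using c by (simp add: g_def)
  have kap: "\<kappa> > 0" using g by (simp add: \<kappa>_def add_nonneg_pos)
  have "\<theta>\<^sup>2 + 1 > 0" by (simp add: add_nonneg_pos)
  then have "(\<theta>\<^sup>2 + 1) * \<kappa> = g" by (simp add: \<kappa>_def)
  then have "\<theta>\<^sup>2 * \<kappa> \<le> g" using kap by (simp add: algebra_simps)
  moreover have "\<theta>\<^sup>2 * (s + \<kappa>) / 2 = \<theta>\<^sup>2 * s / 2 + \<theta>\<^sup>2 * \<kappa> / 2" by (simp add: algebra_simps add_divide_distrib)
  ultimately have c': "c < \<theta> * x - \<theta>\<^sup>2 * (s + \<kappa>) / 2" using g unfolding g_def by linarith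
  obtain \<eta> where "\<eta> > 0" and \<eta>: "\<And>\<theta>. \<forall>\<^sub>F k in sequentially. \<forall>n. \<bar>real n / b k - s\<bar> < \<eta> \<longrightarrow>
    integrable M (\<lambda>\<omega>. exp (\<theta> * v k * (S n \<omega> / a k))) \<and>
    exp (v k * (\<theta>\<^sup>2 * (s - \<kappa>) / 2)) \<le> expectation (\<lambda>\<omega>. exp (\<theta> * v k * (S n \<omega> / a k))) \<and>
    expectation (\<lambda>\<omega>. exp (\<theta> * v k * (S n \<omega> / a k))) \<le> exp (v k * (\<theta>\<^sup>2 * (s + \<kappa>) / 2))"
    using exp_moment_window[OF \<open>s \<ge> 0\<close> kap] by blast
  show ?thesis
  proof (intro exI[of _ \<eta>] conjI \<open>\<eta> > 0\<close>)
    show "\<forall>\<^sub>F k in sequentially. \<forall>n. \<bar>real n / b k - s\<bar> < \<eta> \<longrightarrow>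
      prob {\<omega> \<in> space M. x \<le> \<bar>S n \<omega> / a k\<bar>} \<le> exp (- c * v k)"
      using \<eta>[of \<theta>] \<eta>[of "- \<theta>"] eventually_exp_le[OF c', of 2, simplified] v_pos
    proof eventually_elim
      case (elim k)
      show ?case
      proof (intro allI impI)
        fix n assume n: "\<bar>real n / b k - s\<bar> < \<eta>"
        define l where "l = \<theta> * v k"
        have "l \<ge> 0" using \<open>\<theta> \<ge> 0\<close> elim by (simp add: l_def)
        let ?Z = "\<lambda>\<omega>. S n \<omega> / a k"
        \<comment> \<open>The sign \<open>\<sigma>\<close> treats both tails together: it flips tilt
          and threshold, so \<open>l' * x'\<close> is unchanged.\<close>
        have one: "prob {\<omega> \<in> space M. l' * ?Z \<omega> \<ge> l' * x'} \<le> exp (- (\<theta> * x - \<theta>\<^sup>2 * (s + \<kappa>) / 2) * v k)"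
          if l: "l' = \<sigma> * l" "x' = \<sigma> * x" "\<sigma> = 1 \<or> \<sigma> = - 1" for \<sigma> l' x'
        proof -
          have E: "integrable M (\<lambda>\<omega>. exp (l' * ?Z \<omega>))"
            "expectation (\<lambda>\<omega>. exp (l' * ?Z \<omega>)) \<le> exp (v k * (\<theta>\<^sup>2 * (s + \<kappa>) / 2))"
            using elim(1,2)[rule_format, OF n] l by (auto simp: l_def)
          have "l' * x' = \<theta> * x * v k" using l by (auto simp: l_def)
          then have "prob {\<omega> \<in> space M. l' * ?Z \<omega> \<ge> l' * x'} \<le>
              exp (- (\<theta> * x * v k)) * expectation (\<lambda>\<omega>. exp (l' * ?Z \<omega>))"
            using chernoff_signed[OF _ E(1), of x'] by simp
          also have "\<dots> \<le> exp (- (\<theta> * x * v k)) * exp (v k * (\<theta>\<^sup>2 * (s + \<kappa>) / 2))"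
            by (intro mult_left_mono E) simp
          also have "\<dots> = exp (- (\<theta> * x - \<theta>\<^sup>2 * (s + \<kappa>) / 2) * v k)"
            unfolding exp_add[symmetric] by (simp add: algebra_simps)
          finally show ?thesis .
        qed
        have "prob {\<omega> \<in> space M. x \<le> \<bar>?Z \<omega>\<bar>} \<le>
            prob ({\<omega> \<in> space M. l * ?Z \<omega> \<ge> l * x} \<union> {\<omega> \<in> space M. - l * ?Z \<omega> \<ge> - l * - x})"
        proof (intro finite_measure_mono subsetI)
          fix \<omega> assume \<omega>: "\<omega> \<in> {\<omega> \<in> space M. x \<le> \<bar>?Z \<omega>\<bar>}"
          then consider "x \<le> ?Z \<omega>" | "x \<le> - ?Z \<omega>" by (auto simp: abs_if split: if_splits)
          then show "\<omega> \<in> {\<omega> \<in> space M. l * ?Z \<omega> \<ge> l * x} \<union> {\<omega> \<in> space M. - l * ?Z \<omega> \<ge> - l * - x}"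
            by cases (use \<omega> mult_left_mono[OF _ \<open>l \<ge> 0\<close>] in fastforce)+
        qed measurable
        also have "\<dots> \<le> prob {\<omega> \<in> space M. l * ?Z \<omega> \<ge> l * x} + prob {\<omega> \<in> space M. - l * ?Z \<omega> \<ge> - l * - x}"
          by (intro measure_Un_le) measurable
        also have "\<dots> \<le> 2 * exp (- (\<theta> * x - \<theta>\<^sup>2 * (s + \<kappa>) / 2) * v k)"
          using one[of l 1 x] one[of "- l" "- 1" "- x"] by simp
        also have "\<dots> \<le> exp (- c * v k)" using elim(3) by simp
        finally show "prob {\<omega> \<in> space M. x \<le> \<bar>?Z \<omega>\<bar>} \<le> exp (- c * v k)" .
      qed
    qed
  qed
qed

text \<open>Tilting by \<open>\<theta> = y / s\<close> centres \<open>S n / a k\<close> near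
  \<open>\<theta> * s = y\<close>. The cost is \<open>\<theta> * y - \<theta>\<^sup>2 * s / 2 =
  y\<^sup>2 / (2 * s)\<close>, up to errors paid from the slack in \<open>c\<close>.\<close>

lemma partial_sum_ball_lower:
  assumes "s > 0" "\<epsilon> > 0" and c: "y\<^sup>2 / (2 * s) < c"
  shows "\<exists>\<eta>>0. \<forall>\<^sub>F k in sequentially. \<forall>n. \<bar>real n / b k - s\<bar> < \<eta> \<longrightarrow>
    exp (- c * v k) \<le> prob {\<omega> \<in> space M. \<bar>S n \<omega> / a k - y\<bar> < \<epsilon>}"
proof -
  \<comment> \<open>The slack \<open>g\<close> is spent as a quarter on the ball radius
    (\<open>\<bar>\<theta>\<bar> * e\<close>), a quarter on the window
    (\<open>\<kappa> * \<theta>\<^sup>2 / 2\<close>), and the remaining half on a final factor 2.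
    The extra tilt \<open>\<delta> = e / s\<close> minimises
    \<open>\<delta>\<^sup>2 * s / 2 - \<delta> * e\<close>, with minimum
    \<open>- 2 * \<rho>\<close>.\<close>
  define g where "g = c - y\<^sup>2 / (2 * s)"
  define \<theta> where "\<theta> = y / s"
  define e where "e = min \<epsilon> (g / (4 * (\<bar>\<theta>\<bar> + 1)))"
  define \<delta> where "\<delta> = e / s"
  define \<rho> where "\<rho> = e\<^sup>2 / (4 * s)"
  \<comment> \<open>\<open>Q\<close> bounds the squares of a shifted and the central tilt together,
    so \<open>\<kappa> * Q \<le> \<rho>\<close> controls the window error in comparing their
    moments.\<close>
  define Q where "Q = (\<bar>\<theta>\<bar> + \<delta>)\<^sup>2 + \<theta>\<^sup>2 + 1"
  define \<kappa> where "\<kappa> = min \<rho> (g / 4) / Q"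
  define A where "A = \<theta>\<^sup>2 * (s - \<kappa>) / 2"
  have g: "g > 0" using c by (simp add: g_def)
  have e: "e > 0" "e \<le> \<epsilon>" using g \<open>\<epsilon> > 0\<close> by (auto simp: e_def)
  have "\<delta> > 0" "\<rho> > 0" using e \<open>s > 0\<close> by (auto simp: \<delta>_def \<rho>_def)
  have "Q > 0" by (simp add: Q_def add_nonneg_pos)
  then have kap: "\<kappa> > 0" "\<kappa> * Q \<le> \<rho>" "\<kappa> * Q \<le> g / 4"
    using g \<open>\<rho> > 0\<close> by (auto simp: \<kappa>_def)
  have \<theta>e: "\<bar>\<theta>\<bar> * e \<le> g / 4"
  proof -
    have "\<bar>\<theta>\<bar> * e \<le> (\<bar>\<theta>\<bar> + 1) * (g / (4 * (\<bar>\<theta>\<bar> + 1)))"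
      using e by (intro mult_mono) (auto simp: e_def)
    also have "\<dots> = g / 4" by (simp add: field_simps)
    finally show ?thesis .
  qed
  have "\<theta>\<^sup>2 \<le> Q" by (simp add: Q_def)
  then have kt: "\<kappa> * \<theta>\<^sup>2 / 2 \<le> g / 4"
    using mult_left_mono[of "\<theta>\<^sup>2" Q \<kappa>] kap g by linarith
  have \<theta>s: "\<theta> * s = y" using \<open>s > 0\<close> by (simp add: \<theta>_def)
  have \<delta>s: "\<delta> * s = e" using \<open>s > 0\<close> by (simp add: \<delta>_def)
  \<comment> \<open>Both side terms are exponentially smaller than the main term. Since
    \<open>\<theta> * s = y\<close>, the terms linear in \<open>\<delta>\<close> that contain
    \<open>y\<close> cancel, leaving \<open>- 2 * \<rho>\<close> plus a window error of at most
    \<open>\<rho> / 2\<close>.\<close>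
  have tilt: "- \<sigma> * \<delta> * y - \<delta> * e + (\<theta> + \<sigma> * \<delta>)\<^sup>2 * (s + \<kappa>) / 2 \<le> A - \<rho>" if "\<sigma> = 1 \<or> \<sigma> = - 1" for \<sigma>
  proof -
    have sq: "\<sigma>\<^sup>2 = 1" using that by auto
    have "\<bar>\<theta> + \<sigma> * \<delta>\<bar> \<le> \<bar>\<theta>\<bar> + \<delta>" using that \<open>\<delta> > 0\<close> by auto
    then have "(\<theta> + \<sigma> * \<delta>)\<^sup>2 \<le> (\<bar>\<theta>\<bar> + \<delta>)\<^sup>2" by (metis abs_ge_zero power2_abs power_mono)
    then have "(\<theta> + \<sigma> * \<delta>)\<^sup>2 + \<theta>\<^sup>2 \<le> Q" by (simp add: Q_def)
    then have *: "\<kappa> * ((\<theta> + \<sigma> * \<delta>)\<^sup>2 + \<theta>\<^sup>2) \<le> \<rho>"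
      using mult_left_mono[of _ Q \<kappa>] kap by (meson less_imp_le order_trans)
    have "(\<theta> + \<sigma> * \<delta>)\<^sup>2 * s = \<theta>\<^sup>2 * s + 2 * \<sigma> * \<delta> * (\<theta> * s) + \<sigma>\<^sup>2 * \<delta> * (\<delta> * s)"
      by (simp add: power2_eq_square algebra_simps)
    then have s: "(\<theta> + \<sigma> * \<delta>)\<^sup>2 * s = \<theta>\<^sup>2 * s + 2 * \<sigma> * \<delta> * y + \<delta> * e"
      by (simp add: \<theta>s \<delta>s sq)
    have de: "\<delta> * e = 4 * \<rho>" using \<open>s > 0\<close> by (simp add: \<delta>_def \<rho>_def power2_eq_square)
    have "- \<sigma> * \<delta> * y - \<delta> * e + (\<theta> + \<sigma> * \<delta>)\<^sup>2 * (s + \<kappa>) / 2 - A =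
        - \<sigma> * \<delta> * y - \<delta> * e + ((\<theta> + \<sigma> * \<delta>)\<^sup>2 * s - \<theta>\<^sup>2 * s) / 2 + \<kappa> * ((\<theta> + \<sigma> * \<delta>)\<^sup>2 + \<theta>\<^sup>2) / 2"
      by (simp add: A_def field_simps)
    also have "\<dots> = - (2 * \<rho>) + \<kappa> * ((\<theta> + \<sigma> * \<delta>)\<^sup>2 + \<theta>\<^sup>2) / 2"
      unfolding s using de by (simp add: field_simps)
    finally show ?thesis using * \<open>\<rho> > 0\<close> by linarith
  qed
  obtain \<eta> where "\<eta> > 0" and \<eta>: "\<And>\<theta>. \<forall>\<^sub>F k in sequentially. \<forall>n. \<bar>real n / b k - s\<bar> < \<eta> \<longrightarrow>
    integrable M (\<lambda>\<omega>. exp (\<theta> * v k * (S n \<omega> / a k))) \<and>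
    exp (v k * (\<theta>\<^sup>2 * (s - \<kappa>) / 2)) \<le> expectation (\<lambda>\<omega>. exp (\<theta> * v k * (S n \<omega> / a k))) \<and>
    expectation (\<lambda>\<omega>. exp (\<theta> * v k * (S n \<omega> / a k))) \<le> exp (v k * (\<theta>\<^sup>2 * (s + \<kappa>) / 2))"
    using exp_moment_window[of s \<kappa>] \<open>s > 0\<close> kap(1) by (meson less_imp_le)
  have cg: "c - g / 2 < c" using g by simp
  show ?thesis
  proof (intro exI[of _ \<eta>] conjI \<open>\<eta> > 0\<close>)
    show "\<forall>\<^sub>F k in sequentially. \<forall>n. \<bar>real n / b k - s\<bar> < \<eta> \<longrightarrow>
      exp (- c * v k) \<le> prob {\<omega> \<in> space M. \<bar>S n \<omega> / a k - y\<bar> < \<epsilon>}"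
      using \<eta>[of \<theta>] \<eta>[of "\<theta> + \<delta>"] \<eta>[of "\<theta> - \<delta>"] v_pos
        eventually_exp_le[OF cg, of 2, simplified] eventually_exp_le[OF \<open>\<rho> > 0\<close>, of 4, simplified]
    proof eventually_elim
      case (elim k)
      show ?case
      proof (intro allI impI)
        fix n assume n: "\<bar>real n / b k - s\<bar> < \<eta>"
        let ?Z = "\<lambda>\<omega>. S n \<omega> / a k"
        let ?E = "\<lambda>\<theta>. expectation (\<lambda>\<omega>. exp (\<theta> * v k * ?Z \<omega>))"
        note E = elim(1)[rule_format, OF n] elim(2)[rule_format, OF n] elim(3)[rule_format, OF n]
        have v: "v k > 0" by (rule elim)
        have side: "exp (v k * (- \<sigma> * \<delta> * y - \<delta> * e)) * ?E (\<theta> + \<sigma> * \<delta>) \<le> exp (v k * A) * exp (- \<rho> * v k)"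
          if "\<sigma> = 1 \<or> \<sigma> = - 1" for \<sigma>
        proof -
          have "?E (\<theta> + \<sigma> * \<delta>) \<le> exp (v k * ((\<theta> + \<sigma> * \<delta>)\<^sup>2 * (s + \<kappa>) / 2))" using that E by auto
          then have "exp (v k * (- \<sigma> * \<delta> * y - \<delta> * e)) * ?E (\<theta> + \<sigma> * \<delta>) \<le>
              exp (v k * (- \<sigma> * \<delta> * y - \<delta> * e)) * exp (v k * ((\<theta> + \<sigma> * \<delta>)\<^sup>2 * (s + \<kappa>) / 2))"
            by (intro mult_left_mono) auto
          also have "\<dots> = exp (v k * (- \<sigma> * \<delta> * y - \<delta> * e + (\<theta> + \<sigma> * \<delta>)\<^sup>2 * (s + \<kappa>) / 2))"
            unfolding exp_add[symmetric] by (simp only: distrib_left)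
          also have "\<dots> \<le> exp (v k * (A - \<rho>))"
            using mult_left_mono[OF tilt[OF that], of "v k"] v by simp
          also have "\<dots> = exp (v k * A) * exp (- \<rho> * v k)"
            unfolding exp_add[symmetric] by (simp add: algebra_simps)
          finally show ?thesis .
        qed
        have s1: "exp (- (\<delta> * v k) * (y + e)) * ?E (\<theta> + \<delta>) \<le> exp (v k * A) * exp (- \<rho> * v k)"
        proof -
          have *: "v k * (- 1 * \<delta> * y - \<delta> * e) = - (\<delta> * v k) * (y + e)" by (simp add: algebra_simps)
          show ?thesis using side[of 1, unfolded *] by simp
        qed
        have s2: "exp ((\<delta> * v k) * (y - e)) * ?E (\<theta> - \<delta>) \<le> exp (v k * A) * exp (- \<rho> * v k)"
        proof -
          have *: "v k * (- (- 1) * \<delta> * y - \<delta> * e) = (\<delta> * v k) * (y - e)" by (simp add: algebra_simps)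
          show ?thesis using side[of "- 1", unfolded *] by simp
        qed
        have s0: "exp (v k * A) \<le> ?E \<theta>" using E by (simp add: A_def)
        \<comment> \<open>Each side term is at most a quarter of the main term, so half of the
          tilted mass remains in the ball.\<close>
        have "exp (v k * A) * exp (- \<rho> * v k) * 4 \<le> exp (v k * A)"
          using mult_left_mono[OF elim(6), of "exp (v k * A)"] by simp
        with s0 s1 s2 have par: "exp (v k * A) / 2 \<le> ?E \<theta>
            - exp (- (\<delta> * v k) * (y + e)) * ?E (\<theta> + \<delta>) - exp ((\<delta> * v k) * (y - e)) * ?E (\<theta> - \<delta>)"
          by linarith
        \<comment> \<open>Thus \<open>- \<theta> * y + \<theta>\<^sup>2 * s / 2 = g - c\<close>,
          from which the two errors of at most \<open>g / 4\<close> are subtracted.\<close>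
        have "\<theta> * y = y\<^sup>2 / s" "\<theta>\<^sup>2 * s = y\<^sup>2 / s"
          using \<open>s > 0\<close> by (auto simp: \<theta>_def power2_eq_square)
        then have "- (c - g / 2) \<le> - \<theta> * y - \<bar>\<theta>\<bar> * e + A"
          using \<theta>e kt by (simp add: A_def g_def field_simps)
        then have "exp (- (c - g / 2) * v k) \<le> exp ((- \<theta> * y - \<bar>\<theta>\<bar> * e + A) * v k)"
          using mult_right_mono[OF _ less_imp_le[OF v]] by (simp only: exp_le_cancel_iff)
        also have "(- \<theta> * y - \<bar>\<theta>\<bar> * e + A) * v k = (- (\<theta> * v k) * y - \<bar>\<theta> * v k\<bar> * e) + v k * A"
          using v by (simp add: abs_mult algebra_simps)
        finally have tot: "exp (- (c - g / 2) * v k) \<le>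
            exp (- (\<theta> * v k) * y - \<bar>\<theta> * v k\<bar> * e) * exp (v k * A)"
          by (simp add: exp_add del: minus_diff_eq)
        have "exp (- c * v k) \<le> exp (- (c - g / 2) * v k) / 2" using elim(5) by simp
        also have "\<dots> \<le> exp (- (\<theta> * v k) * y - \<bar>\<theta> * v k\<bar> * e) * (exp (v k * A) / 2)"
          using tot by simp
        also have "\<dots> \<le> exp (- (\<theta> * v k) * y - \<bar>\<theta> * v k\<bar> * e) * (?E \<theta>
            - exp (- (\<delta> * v k) * (y + e)) * ?E (\<theta> + \<delta>) - exp ((\<delta> * v k) * (y - e)) * ?E (\<theta> - \<delta>))"
          by (intro mult_left_mono par) simp
        also have "\<dots> \<le> prob {\<omega> \<in> space M. \<bar>?Z \<omega> - y\<bar> < e}"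
          using tilted_ball_lower_bound[of ?Z "\<delta> * v k" "\<theta> * v k" y e] E v \<open>\<delta> > 0\<close>
          by (simp add: distrib_right left_diff_distrib)
        also have "\<dots> \<le> prob {\<omega> \<in> space M. \<bar>?Z \<omega> - y\<bar> < \<epsilon>}"
          using e by (intro finite_measure_mono) (auto intro: less_le_trans)
        finally show "exp (- c * v k) \<le> prob {\<omega> \<in> space M. \<bar>?Z \<omega> - y\<bar> < \<epsilon>}" .
      qed
    qed
  qed
qed

end

subsection \<open>Random sums\<close>

locale random_index_scaling = iid_moderate_scaling +
  fixes \<nu> :: "nat \<Rightarrow> 'a \<Rightarrow> nat" and I :: "real \<Rightarrow> ereal"
  assumes \<nu>_rv: "\<And>k. k \<ge> 1 \<Longrightarrow> \<nu> k \<in> measurable M (count_space UNIV)"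
    and \<nu>_indep: "\<And>k. k \<ge> 1 \<Longrightarrow>
      indep_rv M (count_space UNIV) (\<nu> k) (\<Pi>\<^sub>M i\<in>{1..}. borel) (\<lambda>\<omega>. \<lambda>i\<in>{1..}. X i \<omega>)"
    and \<nu>_LDP: "satisfies_LDP M (\<lambda>k \<omega>. real (\<nu> k \<omega>) / b k) v I"
    and I_convex: "convex_ereal I"
    and I_lim: "(I \<longlongrightarrow> \<infinity>) at_top"
    and I_nondegenerate: "\<exists>s>0. I s < \<infinity>"
begin

definition Z :: "nat \<Rightarrow> 'a \<Rightarrow> real" where
  "Z k \<omega> = S (\<nu> k \<omega>) \<omega> / a k"

lemma Z_measurable: "k \<ge> 1 \<Longrightarrow> Z k \<in> borel_measurable M"
proof -
  assume "k \<ge> 1"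
  note [measurable] = \<nu>_rv[OF this]
  have "(\<lambda>\<omega>. (\<lambda>n \<omega>. S n \<omega> / a k) (\<nu> k \<omega>) \<omega>) \<in> borel_measurable M"
    by (rule measurable_compose_countable) measurable
  then show ?thesis by (simp add: Z_def[abs_def])
qed

lemma I_good: "good_rate_function I"
  using \<nu>_LDP by (simp add: satisfies_LDP_def)

lemma index_lower:
  "open G \<Longrightarrow> (INF x\<in>G. I x) < ereal c \<Longrightarrow>
    \<forall>\<^sub>F k in sequentially. exp (- c * v k) \<le> prob {\<omega> \<in> space M. real (\<nu> k \<omega>) / b k \<in> G}"
  using \<nu>_LDP unfolding satisfies_LDP_iff[OF prob_space_axioms] by blast

lemma index_upper:
  "closed A \<Longrightarrow> ereal c < (INF x\<in>A. I x) \<Longrightarrow>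
    \<forall>\<^sub>F k in sequentially. prob {\<omega> \<in> space M. real (\<nu> k \<omega>) / b k \<in> A} \<le> exp (- c * v k)"
  using \<nu>_LDP unfolding satisfies_LDP_iff[OF prob_space_axioms] by blast

lemma b_pos: "\<forall>\<^sub>F k in sequentially. b k > 0"
  using b_eq a_pos v_pos by eventually_elim (metis zero_less_mult_pos2 zero_less_power)

text \<open>A finite value would, by the lower bound on the open negative half-line, give positive
  probability to a negative normalised index.\<close>

lemma I_negative: "z < 0 \<Longrightarrow> I z = \<infinity>"
proof (rule ccontr)
  assume z: "z < 0" "I z \<noteq> \<infinity>"
  then obtain c where "I z < ereal c" using ereal_dense2[of "I z" \<infinity>] by auto
  then have "(INF x\<in>{..<0}. I x) < ereal c" using z by (auto simp: INF_less_iff)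
  then have "\<forall>\<^sub>F k in sequentially. exp (- c * v k) \<le> prob {\<omega> \<in> space M. real (\<nu> k \<omega>) / b k \<in> {..<0}}"
    by (intro index_lower) auto
  with b_pos have "\<forall>\<^sub>F k in sequentially. False"
  proof eventually_elim
    case (elim k)
    have *: "{\<omega> \<in> space M. real (\<nu> k \<omega>) / b k \<in> {..<0}} = {}"
      using elim(1) by (auto simp: not_less)
    show ?case using elim(2) unfolding * by (simp add: not_le[symmetric])
  qed
  then show False by simp
qed

text \<open>Total mass one and the upper bound on the whole line force the infimum of
  \<open>I\<close> to be 0. Negative points have infinite cost, and convexity handles the point 0,
  so the infimum may be taken over \<open>s > 0\<close>. This makes the bound trivial for closed
  sets containing 0.\<close>

lemma rate_zero: "gaussian_mixture_rate I 0 \<le> 0"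
proof -
  obtain s0 where s0: "s0 > 0" "I s0 < \<infinity>" using I_nondegenerate by blast
  have "gaussian_mixture_rate I 0 \<le> I z" for z
  proof (cases z "0 :: real" rule: linorder_cases)
    case less
    then show ?thesis by (simp add: I_negative)
  next
    case equal
    then show ?thesis using gaussian_mixture_rate_zero_le[OF I_good I_convex s0] by simp
  next
    case greater
    then show ?thesis using gaussian_mixture_rate_le[of z I 0] by simp
  qed
  then have "gaussian_mixture_rate I 0 \<le> (INF x\<in>UNIV. I x)" by (intro INF_greatest)
  also have "\<dots> \<le> 0"
  proof (rule ccontr)
    assume "\<not> ?thesis"
    then obtain c where c: "0 < ereal c" "ereal c < (INF x\<in>UNIV. I x)" using ereal_dense2 by (meson not_le)
    have "\<forall>\<^sub>F k in sequentially. prob {\<omega> \<in> space M. real (\<nu> k \<omega>) / b k \<in> UNIV} \<le> exp (- c * v k)"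
      using c(2) by (intro index_upper) auto
    with v_pos have "\<forall>\<^sub>F k in sequentially. False"
    proof eventually_elim
      case (elim k)
      have "1 \<le> exp (- c * v k)" using elim(2) by (simp add: prob_space)
      moreover have "c * v k > 0" using elim(1) c(1) by simp
      ultimately show ?case by simp
    qed
    then show False by simp
  qed
  finally show ?thesis .
qed

section \<open>Upper bound for closed sets\<close>

text \<open>By independence the costs add: roughly \<open>I s\<close> for an index near
  \<open>s\<close>, and the Chernoff exponent for the sum given such an index.\<close>

lemma joint_window_upper:
  assumes "s \<ge> 0" "x > 0" and L: "ereal L < gaussian_mixture_rate I x"
  shows "\<exists>\<eta>>0. \<forall>\<^sub>F k in sequentially.
    prob {\<omega> \<in> space M. \<bar>real (\<nu> k \<omega>) / b k - s\<bar> < \<eta> \<and> x \<le> \<bar>Z k \<omega>\<bar>} \<le> exp (- L * v k)"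
proof -
  obtain \<theta> c where \<theta>: "\<theta> \<ge> 0" "ereal c < I s" "L < \<theta> * x - \<theta>\<^sup>2 * s / 2 + c"
  proof (cases "s = 0")
    case True
    \<comment> \<open>At \<open>s = 0\<close> the sum alone costs
      \<open>\<theta> * x = \<bar>L\<bar> + 2\<close>. The index cost can therefore be replaced by
      \<open>- 1\<close>, which lies strictly below \<open>I s\<close>.\<close>
    let ?\<theta> = "(\<bar>L\<bar> + 2) / x"
    have "ereal (- 1) < I s"
      using good_rate_function_nonneg[OF I_good, of s] by (cases "I s") auto
    moreover have "?\<theta> * x = \<bar>L\<bar> + 2" using \<open>x > 0\<close> by simp
    ultimately show ?thesis using \<open>x > 0\<close> True by (intro that[of ?\<theta> "- 1"]) auto
  next
    case False
    then have s: "s > 0" using \<open>s \<ge> 0\<close> by simp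
    have "ereal L < ereal (x\<^sup>2 / (2 * s)) + I s"
      using L gaussian_mixture_rate_le[OF s] by (rule less_le_trans)
    then have "ereal (L - x\<^sup>2 / (2 * s)) < I s" by (cases "I s") auto
    then obtain c where c: "ereal (L - x\<^sup>2 / (2 * s)) < ereal c" "ereal c < I s"
      using ereal_dense2 by blast
    \<comment> \<open>The tilt \<open>x / s\<close> maximises
      \<open>\<theta> * x - \<theta>\<^sup>2 * s / 2\<close>.\<close>
    have "x / s * x - (x / s)\<^sup>2 * s / 2 = x\<^sup>2 / (2 * s)"
      using s by (simp add: power2_eq_square field_simps)
    then show ?thesis using s \<open>x > 0\<close> c by (intro that[of "x / s" c]) auto
  qed
  \<comment> \<open>\<open>L\<close> is split into a sum cost \<open>c1\<close> and an index cost
    \<open>c2\<close>, each strictly below what is available, with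
    \<open>c1 + c2 > L\<close>.\<close>
  obtain c1 where c1: "L - c < c1" "c1 < \<theta> * x - \<theta>\<^sup>2 * s / 2"
    using \<theta>(3) dense[of "L - c" "\<theta> * x - \<theta>\<^sup>2 * s / 2"] by auto
  obtain c2 where c2: "L - c1 < c2" "c2 < c" using c1(1) dense[of "L - c1" c] by auto
  obtain \<eta>1 where \<eta>1: "\<eta>1 > 0" "\<forall>\<^sub>F k in sequentially. \<forall>n. \<bar>real n / b k - s\<bar> < \<eta>1 \<longrightarrow>
      prob {\<omega> \<in> space M. x \<le> \<bar>S n \<omega> / a k\<bar>} \<le> exp (- c1 * v k)"
    using abs_partial_sum_upper[OF \<open>s \<ge> 0\<close> \<theta>(1) c1(2)] by blast
  obtain \<eta>2 where \<eta>2: "\<eta>2 > 0" "\<And>t. dist t s < \<eta>2 \<Longrightarrow> ereal c < I t"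
    using good_rate_function_lower_semicontinuous[OF I_good \<theta>(2)] by (auto simp: eventually_nhds_metric)
  \<comment> \<open>Halving \<open>\<eta>2\<close> keeps the closed ball inside the neighbourhood
    where \<open>I > c\<close>; the upper bound for the index requires a closed set.\<close>
  define \<eta> where "\<eta> = min \<eta>1 (\<eta>2 / 2)"
  have \<eta>: "\<eta> > 0" "\<eta> \<le> \<eta>1" "\<eta> < \<eta>2" using \<eta>1(1) \<eta>2(1) by (auto simp: \<eta>_def)
  have "ereal c \<le> (INF t\<in>cball s \<eta>. I t)"
    using \<eta>2(2) \<eta> by (intro INF_greatest less_imp_le) (auto simp: dist_commute)
  then have "ereal c2 < (INF t\<in>cball s \<eta>. I t)" using c2(2) by (meson less_ereal.simps(1) less_le_trans)
  then have up: "\<forall>\<^sub>F k in sequentially. prob {\<omega> \<in> space M. real (\<nu> k \<omega>) / b k \<in> cball s \<eta>} \<le> exp (- c2 * v k)"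
    by (intro index_upper) auto
  show ?thesis
  proof (intro exI[of _ \<eta>] conjI \<eta>(1))
    show "\<forall>\<^sub>F k in sequentially.
      prob {\<omega> \<in> space M. \<bar>real (\<nu> k \<omega>) / b k - s\<bar> < \<eta> \<and> x \<le> \<bar>Z k \<omega>\<bar>} \<le> exp (- L * v k)"
      using up \<eta>1(2) v_pos eventually_ge_at_top[of 1]
    proof eventually_elim
      case (elim k)
      note [measurable] = \<nu>_rv[OF elim(4)]
      let ?P = "\<lambda>n. \<bar>real n / b k - s\<bar> < \<eta>"
      have "prob {\<omega> \<in> space M. ?P (\<nu> k \<omega>) \<and> S (\<nu> k \<omega>) \<omega> \<in> {z. x \<le> \<bar>z / a k\<bar>}} \<le>
          prob {\<omega> \<in> space M. ?P (\<nu> k \<omega>)} * exp (- c1 * v k)"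
      proof (rule random_index_upper[OF \<nu>_rv[OF elim(4)] \<nu>_indep[OF elim(4)]])
        show "{z. x \<le> \<bar>z / a k\<bar>} \<in> sets borel" by measurable
        show "prob {\<omega> \<in> space M. S n \<omega> \<in> {z. x \<le> \<bar>z / a k\<bar>}} \<le> exp (- c1 * v k)" if "?P n" for n
          using elim(2)[rule_format, of n] that \<eta>(2) by simp
      qed
      also have "prob {\<omega> \<in> space M. ?P (\<nu> k \<omega>)} \<le> prob {\<omega> \<in> space M. real (\<nu> k \<omega>) / b k \<in> cball s \<eta>}"
        by (intro finite_measure_mono) (auto simp: dist_real_def abs_minus_commute)
      also have "\<dots> \<le> exp (- c2 * v k)" by (rule elim)
      also have "exp (- c2 * v k) * exp (- c1 * v k) = exp (- (c1 + c2) * v k)"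
        by (simp add: algebra_simps flip: exp_add)
      also have "\<dots> \<le> exp (- L * v k)"
      proof -
        have "L * v k \<le> (c1 + c2) * v k" using c2 elim(3) by (intro mult_right_mono) auto
        then show ?thesis by (simp only: exp_le_cancel_iff mult_minus_left neg_le_iff_le)
      qed
      finally show ?case by (simp add: Z_def mult_right_mono)
    qed
  qed
qed

text \<open>Exponential tightness of the index, from \<open>I_lim\<close>. The level
  \<open>L + 1\<close> keeps the inequality strict after passing to the infimum.\<close>

lemma index_tail_upper: "\<exists>R\<ge>0. \<forall>\<^sub>F k in sequentially. prob {\<omega> \<in> space M. R \<le> real (\<nu> k \<omega>) / b k} \<le> exp (- L * v k)"
proof -
  have "\<forall>\<^sub>F s in at_top. ereal (L + 1) < I s" using I_lim by (simp add: tendsto_PInfty)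
  then obtain R where R: "\<And>s. s \<ge> R \<Longrightarrow> ereal (L + 1) < I s" by (auto simp: eventually_at_top_linorder)
  have "ereal L < ereal (L + 1)" by simp
  also have "\<dots> \<le> (INF s\<in>{max R 0..}. I s)"
    using R by (intro INF_greatest less_imp_le) auto
  finally have "\<forall>\<^sub>F k in sequentially. prob {\<omega> \<in> space M. real (\<nu> k \<omega>) / b k \<in> {max R 0..}} \<le> exp (- L * v k)"
    by (intro index_upper) auto
  then show ?thesis by (intro exI[of _ "max R 0"]) simp
qed

lemma abs_random_sum_upper:
  assumes "x > 0" and L: "ereal L < gaussian_mixture_rate I x"
  shows "\<forall>\<^sub>F k in sequentially. prob {\<omega> \<in> space M. x \<le> \<bar>Z k \<omega>\<bar>} \<le> exp (- L * v k)"
proof -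
  \<comment> \<open>The gap between \<open>L\<close> and \<open>L1\<close> will absorb the
    \<open>card C + 1\<close> terms of the union bound: one per window and one for the tail.\<close>
  obtain L1 where L1: "L < L1" "ereal L1 < gaussian_mixture_rate I x"
    using ereal_dense2[OF L] by auto
  obtain R where R: "R \<ge> 0" "\<forall>\<^sub>F k in sequentially. prob {\<omega> \<in> space M. R \<le> real (\<nu> k \<omega>) / b k} \<le> exp (- L1 * v k)"
    using index_tail_upper by blast
  let ?E = "\<lambda>\<eta> k s. {\<omega> \<in> space M. \<bar>real (\<nu> k \<omega>) / b k - s\<bar> < \<eta> s \<and> x \<le> \<bar>Z k \<omega>\<bar>}"
  have "\<forall>s\<in>{0..R}. \<exists>\<eta>>0. \<forall>\<^sub>F k in sequentially. prob (?E (\<lambda>_. \<eta>) k s) \<le> exp (- L1 * v k)"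
    using joint_window_upper[OF _ \<open>x > 0\<close> L1(2)] by auto
  from bchoice[OF this] obtain \<eta> where \<eta>: "\<And>s. s \<in> {0..R} \<Longrightarrow> \<eta> s > 0"
    "\<And>s. s \<in> {0..R} \<Longrightarrow> \<forall>\<^sub>F k in sequentially. prob (?E \<eta> k s) \<le> exp (- L1 * v k)"
    by blast
  have "{0..R} \<subseteq> (\<Union>s\<in>{0..R}. ball s (\<eta> s))"
  proof
    fix s assume "s \<in> {0..R}"
    then show "s \<in> (\<Union>s\<in>{0..R}. ball s (\<eta> s))" using \<eta>(1)[of s] by (intro UN_I[of s]) auto
  qed
  then obtain C where C: "C \<subseteq> {0..R}" "finite C" "{0..R} \<subseteq> (\<Union>s\<in>C. ball s (\<eta> s))"
    using compactE_image[of "{0..R}" "{0..R}" "\<lambda>s. ball s (\<eta> s)"] by (auto simp: compact_Icc)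
  have "\<forall>\<^sub>F k in sequentially. \<forall>s\<in>C. prob (?E \<eta> k s) \<le> exp (- L1 * v k)"
    using C(1) \<eta>(2) by (intro eventually_ball_finite C(2)) auto
  then show ?thesis
    using R(2) b_pos eventually_ge_at_top[of 1] eventually_exp_le[OF L1(1), of "real (card C) + 1", simplified]
  proof eventually_elim
    case (elim k)
    note [measurable] = \<nu>_rv[OF elim(4)] Z_measurable[OF elim(4)]
    let ?T = "{\<omega> \<in> space M. R \<le> real (\<nu> k \<omega>) / b k}"
    have T: "?T \<in> events" by measurable
    have U: "(\<Union>s\<in>C. ?E \<eta> k s) \<in> events" by (intro sets.finite_UN C(2)) measurable
    have "{\<omega> \<in> space M. x \<le> \<bar>Z k \<omega>\<bar>} \<subseteq> (\<Union>s\<in>C. ?E \<eta> k s) \<union> ?T"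
    proof
      fix \<omega> assume \<omega>: "\<omega> \<in> {\<omega> \<in> space M. x \<le> \<bar>Z k \<omega>\<bar>}"
      show "\<omega> \<in> (\<Union>s\<in>C. ?E \<eta> k s) \<union> ?T"
      proof (cases "R \<le> real (\<nu> k \<omega>) / b k")
        case False
        then have "real (\<nu> k \<omega>) / b k \<in> {0..R}" using elim(3) by auto
        then obtain s where "s \<in> C" "real (\<nu> k \<omega>) / b k \<in> ball s (\<eta> s)" using C(3) by blast
        then show ?thesis using \<omega> by (auto simp: dist_real_def abs_minus_commute)
      qed (use \<omega> in auto)
    qed
    then have "prob {\<omega> \<in> space M. x \<le> \<bar>Z k \<omega>\<bar>} \<le> prob ((\<Union>s\<in>C. ?E \<eta> k s) \<union> ?T)"
      by (intro finite_measure_mono sets.Un U T)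
    also have "\<dots> \<le> prob (\<Union>s\<in>C. ?E \<eta> k s) + prob ?T"
      by (intro measure_Un_le U T)
    also have "\<dots> \<le> (\<Sum>s\<in>C. prob (?E \<eta> k s)) + prob ?T"
      by (intro add_right_mono measure_UNION_le C(2)) measurable
    also have "\<dots> \<le> (\<Sum>s\<in>C. exp (- L1 * v k)) + exp (- L1 * v k)"
      by (intro add_mono sum_mono) (use elim in auto)
    also have "\<dots> = (real (card C) + 1) * exp (- L1 * v k)" by (simp add: algebra_simps)
    also have "\<dots> \<le> exp (- L * v k)" using elim(5) by simp
    finally show ?case .
  qed
qed

text \<open>With \<open>y\<close> a point of \<open>A\<close> nearest to 0, \<open>A\<close> lies in
  the two-sided tail beyond \<open>\<bar>y\<bar>\<close>, and the rate at \<open>y\<close> already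
  exceeds \<open>c\<close>. If \<open>y = 0\<close>, then \<open>c < 0\<close> and the bound exceeds
  1.\<close>

lemma random_sum_closed_upper:
  assumes A: "closed A" and c: "ereal c < (INF y\<in>A. gaussian_mixture_rate I y)"
  shows "\<forall>\<^sub>F k in sequentially. prob {\<omega> \<in> space M. Z k \<omega> \<in> A} \<le> exp (- c * v k)"
proof (cases "A = {}")
  case False
  then obtain y where y: "y \<in> A" "\<And>z. z \<in> A \<Longrightarrow> dist 0 y \<le> dist 0 z"
    using distance_attains_inf[OF A] by blast
  have cy: "ereal c < gaussian_mixture_rate I y" using c INF_lower[OF y(1)] by (rule less_le_trans)
  show ?thesis
  proof (cases "y = 0")
    case True
    then have "ereal c < 0" using cy rate_zero by (meson less_le_trans)
    then have "c < 0" by simp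
    show ?thesis using v_pos
    proof eventually_elim
      case (elim k)
      have "1 \<le> exp (- c * v k)" using \<open>c < 0\<close> elim by (simp add: mult_nonpos_nonneg)
      then show ?case using order_trans[OF prob_le_1] by blast
    qed
  next
    case False
    have "\<forall>\<^sub>F k in sequentially. prob {\<omega> \<in> space M. \<bar>y\<bar> \<le> \<bar>Z k \<omega>\<bar>} \<le> exp (- c * v k)"
      by (rule abs_random_sum_upper) (use False cy in \<open>auto simp: gaussian_mixture_rate_abs\<close>)
    then show ?thesis using eventually_ge_at_top[of 1]
    proof eventually_elim
      case (elim k)
      note [measurable] = Z_measurable[OF elim(2)]
      have "prob {\<omega> \<in> space M. Z k \<omega> \<in> A} \<le> prob {\<omega> \<in> space M. \<bar>y\<bar> \<le> \<bar>Z k \<omega>\<bar>}"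
        using y(2) by (intro finite_measure_mono) auto
      then show ?case using elim(1) by linarith
    qed
  qed
qed simp

section \<open>Lower bound for open sets\<close>

lemma random_sum_open_lower:
  assumes G: "open G" and c: "(INF y\<in>G. gaussian_mixture_rate I y) < ereal c"
  shows "\<forall>\<^sub>F k in sequentially. exp (- c * v k) \<le> prob {\<omega> \<in> space M. Z k \<omega> \<in> G}"
proof -
  obtain y s where y: "y \<in> G" and s: "s > 0" "ereal (y\<^sup>2 / (2 * s)) + I s < ereal c"
    using c by (auto simp: INF_less_iff gaussian_mixture_rate_less_iff)
  obtain i where i: "I s = ereal i"
    using s(2) good_rate_function_nonneg[OF I_good, of s] by (cases "I s") auto
  have "y\<^sup>2 / (2 * s) < c - i" using s(2) by (simp add: i)
  \<comment> \<open>The cost \<open>c\<close> is shared: \<open>c1\<close> for the sum to be near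
    \<open>y\<close>, and \<open>c - c1 > I s\<close> for the index to be near
    \<open>s\<close>.\<close>
  then obtain c1 where c1: "y\<^sup>2 / (2 * s) < c1" "c1 < c - i" using dense by blast
  obtain \<epsilon> where \<epsilon>: "\<epsilon> > 0" "ball y \<epsilon> \<subseteq> G" using G y by (auto simp: open_contains_ball)
  obtain \<eta> where \<eta>: "\<eta> > 0" "\<forall>\<^sub>F k in sequentially. \<forall>n. \<bar>real n / b k - s\<bar> < \<eta> \<longrightarrow>
      exp (- c1 * v k) \<le> prob {\<omega> \<in> space M. \<bar>S n \<omega> / a k - y\<bar> < \<epsilon>}"
    using partial_sum_ball_lower[OF s(1) \<epsilon>(1) c1(1)] by blast
  have "(INF t\<in>ball s \<eta>. I t) \<le> I s" using \<eta>(1) by (intro INF_lower) simp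
  also have "\<dots> < ereal (c - c1)" using c1(2) by (simp add: i)
  finally have "\<forall>\<^sub>F k in sequentially. exp (- (c - c1) * v k) \<le> prob {\<omega> \<in> space M. real (\<nu> k \<omega>) / b k \<in> ball s \<eta>}"
    by (intro index_lower) auto
  with \<eta>(2) show ?thesis using eventually_ge_at_top[of 1]
  proof eventually_elim
    case (elim k)
    note [measurable] = \<nu>_rv[OF elim(3)] Z_measurable[OF elim(3)] borel_open[OF G]
    let ?P = "\<lambda>n. \<bar>real n / b k - s\<bar> < \<eta>"
    have "exp (- c * v k) = exp (- (c - c1) * v k) * exp (- c1 * v k)"
      by (simp add: algebra_simps flip: exp_add)
    also have "\<dots> \<le> prob {\<omega> \<in> space M. ?P (\<nu> k \<omega>)} * exp (- c1 * v k)"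
      using elim(2) by (intro mult_right_mono) (auto simp: dist_real_def abs_minus_commute)
    also have "\<dots> \<le> prob {\<omega> \<in> space M. ?P (\<nu> k \<omega>) \<and> S (\<nu> k \<omega>) \<omega> \<in> {z. \<bar>z / a k - y\<bar> < \<epsilon>}}"
    proof (rule random_index_lower[OF \<nu>_rv[OF elim(3)] \<nu>_indep[OF elim(3)]])
      show "{z. \<bar>z / a k - y\<bar> < \<epsilon>} \<in> sets borel" by measurable
      show "exp (- c1 * v k) \<le> prob {\<omega> \<in> space M. S n \<omega> \<in> {z. \<bar>z / a k - y\<bar> < \<epsilon>}}" if "?P n" for n
        using elim(1)[rule_format, of n] that by simp
    qed
    also have "\<dots> \<le> prob {\<omega> \<in> space M. Z k \<omega> \<in> G}"
    proof (rule finite_measure_mono)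
      show "{\<omega> \<in> space M. Z k \<omega> \<in> G} \<in> events" by measurable
      have "z \<in> G" if "\<bar>z - y\<bar> < \<epsilon>" for z
        using \<epsilon>(2) that by (auto simp: dist_real_def abs_minus_commute)
      then show "{\<omega> \<in> space M. ?P (\<nu> k \<omega>) \<and> S (\<nu> k \<omega>) \<omega> \<in> {z. \<bar>z / a k - y\<bar> < \<epsilon>}} \<subseteq>
          {\<omega> \<in> space M. Z k \<omega> \<in> G}" by (auto simp: Z_def)
    qed
    finally show ?case .
  qed
qed

theorem random_sum_LDP: "satisfies_LDP M Z v (gaussian_mixture_rate I)"
proof -
  have "good_rate_function (gaussian_mixture_rate I)"
    using I_nondegenerate good_rate_function_gaussian_mixture_rate[OF I_good I_convex] by blast
  then show ?thesis
    unfolding satisfies_LDP_iff[OF prob_space_axioms]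
    by (intro conjI allI impI Z_measurable v_lim random_sum_open_lower random_sum_closed_upper)
qed

end

section \<open>Specialisation to powers of the mean index\<close>

theorem theorem3p10:
  fixes M :: "'a measure"
    and X :: "nat \<Rightarrow> 'a \<Rightarrow> real"
    and \<nu> :: "nat \<Rightarrow> 'a \<Rightarrow> nat"
    and \<mu> :: "nat \<Rightarrow> real"
    and D \<alpha> \<gamma> :: real
    and I :: "real \<Rightarrow> ereal"
  assumes "prob_space M"
    and X_indep: "prob_space.indep_vars M (\<lambda>_. borel) X {1..}"
    and X_ident: "\<And>i. i \<ge> 1 \<Longrightarrow> distr M borel (X i) = distr M borel (X 1)"
    and X_mean: "prob_space.expectation M (X 1) = 0"
    and X_var: "prob_space.variance M (X 1) = 1"
    and "D > 0"
    and X_mgf: "\<And>l. l \<in> {-D<..<D} \<Longrightarrow> integrable M (\<lambda>\<omega>. exp (l * X 1 \<omega>))"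
    and \<nu>_rv: "\<And>k. k \<ge> 1 \<Longrightarrow> \<nu> k \<in> measurable M (count_space UNIV)"
    and \<nu>_pos: "\<And>k \<omega>. k \<ge> 1 \<Longrightarrow> \<omega> \<in> space M \<Longrightarrow> \<nu> k \<omega> > 0"
    and \<nu>_indep: "\<And>k. k \<ge> 1 \<Longrightarrow>
          indep_rv M (count_space UNIV) (\<nu> k)
            (\<Pi>\<^sub>M i\<in>{1..}. borel) (\<lambda>\<omega>. \<lambda>i\<in>{1..}. X i \<omega>)"
    and \<nu>_int: "\<And>k. k \<ge> 1 \<Longrightarrow> integrable M (\<lambda>\<omega>. real (\<nu> k \<omega>))"
    and \<mu>_def: "\<And>k. k \<ge> 1 \<Longrightarrow> \<mu> k = prob_space.expectation M (\<lambda>\<omega>. real (\<nu> k \<omega>))"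
    and \<mu>_lim: "filterlim \<mu> at_top sequentially"
    and "0 < \<alpha>" and "\<alpha> < 1/2"
    and "0 < \<gamma>" and "\<gamma> \<le> 2 * \<alpha>"
    and \<nu>_LDP: "satisfies_LDP M
          (\<lambda>k \<omega>. real (\<nu> k \<omega>) / \<mu> k powr (1 + 2 * \<alpha> - \<gamma>)) (\<lambda>k. \<mu> k powr \<gamma>) I"
    and I_convex: "convex_ereal I"
    and I_lim: "(I \<longlongrightarrow> \<infinity>) at_top"
    and I_nondegenerate: "\<exists>s>0. I s < \<infinity>"
  shows "satisfies_LDP M
          (\<lambda>k \<omega>. 1 / \<mu> k powr (1/2 + \<alpha>) * (\<Sum>i=1..\<nu> k \<omega>. X i \<omega>)) (\<lambda>k. \<mu> k powr \<gamma>)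
          (\<lambda>y. INF s\<in>{0<..}. ereal (y\<^sup>2 / (2 * s)) + I s)"
proof -
  define a b where "a k = \<mu> k powr (1/2 + \<alpha>)" and "b k = \<mu> k powr (1 + 2 * \<alpha> - \<gamma>)" for k
  have \<mu>_pos: "\<forall>\<^sub>F k in sequentially. \<mu> k > 0"
    using \<mu>_lim by (simp add: filterlim_at_top_dense)
  have ratio: "\<mu> k powr \<gamma> / a k = \<mu> k powr - (1/2 + \<alpha> - \<gamma>)" for k
    by (simp add: a_def flip: powr_diff)
  interpret prob_space M by fact
  interpret random_index_scaling M X D a "\<lambda>k. \<mu> k powr \<gamma>" b \<nu> I
  proof unfold_locales
    show "filterlim (\<lambda>k. \<mu> k powr \<gamma>) at_top sequentially"
      using \<nu>_LDP by (simp add: satisfies_LDP_def)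
    show "\<forall>\<^sub>F k in sequentially. a k > 0"
      using \<mu>_pos by eventually_elim (simp add: a_def)
    show "(\<lambda>k. \<mu> k powr \<gamma> / a k) \<longlonglongrightarrow> 0"
      unfolding ratio
      \<comment> \<open>The exponent \<open>1/2 + \<alpha> - \<gamma>\<close> is positive because
        \<open>\<gamma> \<le> 2 * \<alpha> < 1/2 + \<alpha>\<close>.\<close>
      by (rule tendsto_neg_powr[OF _ \<mu>_lim]) (use \<open>\<gamma> \<le> 2 * \<alpha>\<close> \<open>\<alpha> < 1/2\<close> in simp)
    show "\<forall>\<^sub>F k in sequentially. b k * \<mu> k powr \<gamma> = (a k)\<^sup>2"
      using \<mu>_pos by eventually_elim
        (simp add: a_def b_def power2_eq_square flip: powr_add)
    show "satisfies_LDP M (\<lambda>k \<omega>. real (\<nu> k \<omega>) / b k) (\<lambda>k. \<mu> k powr \<gamma>) I"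
      using \<nu>_LDP by (simp add: b_def)
  qed (fact X_indep X_ident X_mean X_var \<open>D > 0\<close> X_mgf \<nu>_rv \<nu>_indep I_convex I_lim I_nondegenerate)+
  have "Z = (\<lambda>k \<omega>. 1 / \<mu> k powr (1/2 + \<alpha>) * (\<Sum>i=1..\<nu> k \<omega>. X i \<omega>))"
    by (intro ext) (simp add: Z_def S_def a_def)
  with random_sum_LDP show ?thesis
    by (simp only: gaussian_mixture_rate_def[abs_def])
qed

end
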